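(* Let $H: L^2(0,1)\to\ell^2$, $[Hx]_j=\int_0^1 x(t)\,t^{j-1}\,dt$ ($j=1,2,\ldots$); let $D:\ell^2\to\ell^2$, $[Dy]_j=y_j/j$ ($j=1,2,\ldots$); and let $C^*: L^2(0,1)\to L^2(0,1)$, $[C^*x](t)=\int_t^1\frac{x(s)}{s}\,ds$ ($0\le t\le 1$). For the compact composition $T=D\,H=H\,C^*: L^2(0,1)\to\ell^2$ there exists a constant $c>0$ such that $$\sigma_i(T)\le \frac{c}{i^{3/2}}\qquad (i=1,2,\ldots),$$ and the degree of ill-posedness of $T$ is at least $3/2$, i.e. $$\liminf_{i\to\infty}\frac{-\log(\sigma_i(T))}{\log(i)}\ \ge\ \frac32 .$$
   Context: $L^2(0,1)$ and $\ell^2$ are real Hilbert spaces; $H$, $D$, $C^*$ are bounded linear operators, and $D\,H=H\,C^*$. For a compact operator $T$, $\sigma_1(T)\ge\sigma_2(T)\ge\ldots>0$ denote its singular values in decreasing order (counted with multiplicity). The interval of ill-posedness of a compact operator $T$ is $$[\underline\kappa,\overline\kappa]=\left[\liminf_{i\to\infty}\frac{-\log(\sigma_i(T))}{\log(i)},\ \limsup_{i\to\infty}\frac{-\log(\sigma_i(T))}{\log(i)}\right]\subset[0,\infty],$$ and if $\underline\kappa=\overline\kappa=\kappa$ is finite and positive, $\kappa$ is called the degree of ill-posedness. *)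

theory Defs
  imports "HOL-Analysis.Analysis"
begin


definition square_integrable :: "'a measure \<Rightarrow> ('a \<Rightarrow> real) \<Rightarrow> bool"
  where "square_integrable M f \<longleftrightarrow> f \<in> borel_measurable M \<and> integrable M (\<lambda>x. (f x)\<^sup>2)"

lemma square_integrable_mult:
  assumes "square_integrable M f" "square_integrable M g"
  shows "integrable M (\<lambda>x. f x * g x)"
proof (rule Bochner_Integration.integrable_bound)
  show "integrable M (\<lambda>x. (f x)\<^sup>2 + (g x)\<^sup>2)"
    using assms by (simp add: square_integrable_def)
  show "(\<lambda>x. f x * g x) \<in> borel_measurable M"
    using assms by (auto simp: square_integrable_def)
  have "\<bar>f x * g x\<bar> \<le> (f x)\<^sup>2 + (g x)\<^sup>2" for x
  proof -
    have "2 * (\<bar>f x\<bar> * \<bar>g x\<bar>) \<le> (f x)\<^sup>2 + (g x)\<^sup>2"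
      using sum_squares_bound[of "\<bar>f x\<bar>" "\<bar>g x\<bar>"] by simp
    moreover have "0 \<le> \<bar>f x\<bar> * \<bar>g x\<bar>" by simp
    ultimately show ?thesis unfolding abs_mult by linarith
  qed
  then show "AE x in M. norm (f x * g x) \<le> norm ((f x)\<^sup>2 + (g x)\<^sup>2)"
    by simp
qed

lemma square_integrable_add:
  assumes "square_integrable M f" "square_integrable M g"
  shows "square_integrable M (\<lambda>x. f x + g x)"
  using assms square_integrable_mult[OF assms]
  by (auto simp: square_integrable_def power2_sum mult.assoc)

lemma square_integrable_scale:
  assumes "square_integrable M f"
  shows "square_integrable M (\<lambda>x. c * f x)"
  using assms by (auto simp: square_integrable_def power_mult_distrib)

lemma square_integrable_minus:
  assumes "square_integrable M f"
  shows "square_integrable M (\<lambda>x. - f x)"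
  using assms by (simp add: square_integrable_def)

lemma square_integrable_diff:
  assumes "square_integrable M f" "square_integrable M g"
  shows "square_integrable M (\<lambda>x. f x - g x)"
  using square_integrable_add[OF assms(1) square_integrable_minus[OF assms(2)]] by simp

lemma square_integrable_zero: "square_integrable M (\<lambda>x. 0)"
  by (simp add: square_integrable_def)

lemma square_integrable_Cauchy_Schwarz:
  assumes "square_integrable M f" "square_integrable M g"
  shows "(\<integral>x. f x * g x \<partial>M)\<^sup>2 \<le> (\<integral>x. (f x)\<^sup>2 \<partial>M) * (\<integral>x. (g x)\<^sup>2 \<partial>M)"
proof -
  define A B C where "A = (\<integral>x. (f x)\<^sup>2 \<partial>M)" and "B = (\<integral>x. f x * g x \<partial>M)"
    and "C = (\<integral>x. (g x)\<^sup>2 \<partial>M)"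
  have fg: "integrable M (\<lambda>x. f x * g x)" by (rule square_integrable_mult[OF assms])
  have quad: "0 \<le> A * a\<^sup>2 + 2 * (a * b * B) + b\<^sup>2 * C" for a b
  proof -
    have "0 \<le> (\<integral>x. (a * f x + b * g x)\<^sup>2 \<partial>M)" by simp
    also have "\<dots> = (\<integral>x. a\<^sup>2 * (f x)\<^sup>2 + (2 * a * b) * (f x * g x) + b\<^sup>2 * (g x)\<^sup>2 \<partial>M)"
      by (simp add: power2_sum power_mult_distrib algebra_simps)
    also have "\<dots> = a\<^sup>2 * A + 2 * a * b * B + b\<^sup>2 * C"
      using fg assms by (simp add: square_integrable_def A_def B_def C_def)
    finally show ?thesis by (simp add: algebra_simps)
  qed
  have A0: "0 \<le> A" and C0: "0 \<le> C" by (simp_all add: A_def C_def)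
  have "B\<^sup>2 \<le> A * C"
  proof (cases "C = 0")
    case False
    then have "C > 0" using C0 by simp
    have "0 \<le> A * C\<^sup>2 + 2 * (C * (-B) * B) + (-B)\<^sup>2 * C" by (rule quad)
    also have "\<dots> = C * (A * C - B\<^sup>2)" by (simp add: power2_eq_square algebra_simps)
    finally show ?thesis using \<open>C > 0\<close> by (simp add: zero_le_mult_iff)
  next
    case True
    have "B = 0"
    proof (rule ccontr)
      assume "B \<noteq> 0"
      have "0 \<le> A * 1\<^sup>2 + 2 * (1 * (-(A + 1) / (2 * B)) * B) + (-(A + 1) / (2 * B))\<^sup>2 * C"
        by (rule quad)
      also have "\<dots> = -1" using True \<open>B \<noteq> 0\<close> by (simp add: field_simps)
      finally show False by simp
    qed
    then show ?thesis using True by simp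
  qed
  then show ?thesis by (simp add: A_def B_def C_def)
qed

abbreviation unit_interval :: "real measure"
  where "unit_interval \<equiv> restrict_space lborel {0<..<1}"

quotient_type L2 = "real \<Rightarrow> real" / partial:
  "\<lambda>f g. square_integrable unit_interval f \<and> square_integrable unit_interval g \<and>
         (AE t in unit_interval. f t = g t)"
proof (rule part_equivpI)
  show "\<exists>f. square_integrable unit_interval f \<and> square_integrable unit_interval f \<and>
         (AE t in unit_interval. f t = f t)"
    by (rule exI[of _ "\<lambda>x. 0"]) (simp add: square_integrable_zero)
  show "symp (\<lambda>f g. square_integrable unit_interval f \<and> square_integrable unit_interval g \<and>
         (AE t in unit_interval. f t = g t))"
    by (auto intro!: sympI elim: AE_mp)
  show "transp (\<lambda>f g. square_integrable unit_interval f \<and> square_integrable unit_interval g \<and>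
         (AE t in unit_interval. f t = g t))"
    by (rule transpI) (auto elim: AE_mp)
qed

instantiation L2 :: real_inner
begin

lift_definition zero_L2 :: L2 is "\<lambda>t. 0"
  by (simp add: square_integrable_zero)

lift_definition plus_L2 :: "L2 \<Rightarrow> L2 \<Rightarrow> L2" is "\<lambda>f g t. f t + g t"
  by (auto intro: square_integrable_add elim: AE_mp)

lift_definition minus_L2 :: "L2 \<Rightarrow> L2 \<Rightarrow> L2" is "\<lambda>f g t. f t - g t"
  by (auto intro: square_integrable_diff elim: AE_mp)

lift_definition uminus_L2 :: "L2 \<Rightarrow> L2" is "\<lambda>f t. - f t"
  by (auto intro: square_integrable_minus elim: AE_mp)

lift_definition scaleR_L2 :: "real \<Rightarrow> L2 \<Rightarrow> L2" is "\<lambda>c f t. c * f t"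
  by (auto intro: square_integrable_scale elim: AE_mp)

lift_definition inner_L2 :: "L2 \<Rightarrow> L2 \<Rightarrow> real" is "\<lambda>f g. \<integral>t. f t * g t \<partial>unit_interval"
  by (intro integral_cong_AE) (auto simp: square_integrable_def elim: AE_mp)

definition norm_L2 :: "L2 \<Rightarrow> real" where "norm_L2 x = sqrt (inner x x)"
definition dist_L2 :: "L2 \<Rightarrow> L2 \<Rightarrow> real" where "dist_L2 x y = norm (x - y)"
definition sgn_L2 :: "L2 \<Rightarrow> L2" where "sgn_L2 x = inverse (norm x) *\<^sub>R x"
definition uniformity_L2 :: "(L2 \<times> L2) filter"
  where "uniformity_L2 = (INF e\<in>{0 <..}. principal {(x, y). dist x y < e})"
definition open_L2 :: "L2 set \<Rightarrow> bool"
  where "open_L2 U \<longleftrightarrow> (\<forall>x\<in>U. eventually (\<lambda>(x', y). x' = x \<longrightarrow> y \<in> U) uniformity)"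

instance
proof
  fix x y z :: L2 and a b :: real and U :: "L2 set"
  show "x + y + z = x + (y + z)" "x + y = y + x" "0 + x = x" "- x + x = 0" "x - y = x + - y"
    by (transfer; auto intro: square_integrable_add square_integrable_diff square_integrable_minus
          square_integrable_zero simp: algebra_simps)+
  show "a *\<^sub>R (x + y) = a *\<^sub>R x + a *\<^sub>R y" "(a + b) *\<^sub>R x = a *\<^sub>R x + b *\<^sub>R x"
    "a *\<^sub>R b *\<^sub>R x = (a * b) *\<^sub>R x" "1 *\<^sub>R x = x"
    by (transfer; auto intro!: square_integrable_add square_integrable_scale simp: algebra_simps)+
  show "inner x y = inner y x"
    by transfer (simp add: mult.commute)
  show "inner (x + y) z = inner x z + inner y z"
    by transfer (simp add: distrib_right square_integrable_mult)
  show "inner (a *\<^sub>R x) y = a * inner x y"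
    by transfer (simp add: mult.assoc)
  show "0 \<le> inner x x"
    by transfer simp
  show "inner x x = 0 \<longleftrightarrow> x = 0"
    by transfer (auto simp: square_integrable_def integral_nonneg_eq_0_iff_AE
        simp flip: power2_eq_square)
qed (simp_all add: norm_L2_def dist_L2_def sgn_L2_def uniformity_L2_def open_L2_def)

end

typedef ell2 = "{f :: nat \<Rightarrow> real. summable (\<lambda>j. (f j)\<^sup>2)}"
  morphisms ell2_nth Abs_ell2
  by (rule exI[of _ "\<lambda>j. 0"]) simp

setup_lifting type_definition_ell2

lemma ell2_iff_square_integrable:
  "summable (\<lambda>j. (f j)\<^sup>2) \<longleftrightarrow> square_integrable (count_space UNIV) (f :: nat \<Rightarrow> real)"
  by (simp add: square_integrable_def integrable_count_space_nat_iff)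

lemma ell2_summable_mult:
  fixes f g :: "nat \<Rightarrow> real"
  assumes "summable (\<lambda>j. (f j)\<^sup>2)" "summable (\<lambda>j. (g j)\<^sup>2)"
  shows "summable (\<lambda>j. f j * g j)"
  using square_integrable_mult[of "count_space UNIV" f g] assms
  unfolding ell2_iff_square_integrable
  by (auto simp: integrable_count_space_nat_iff intro: summable_norm_cancel)

instantiation ell2 :: real_inner
begin

lift_definition zero_ell2 :: ell2 is "\<lambda>j. 0"
  by simp

lift_definition plus_ell2 :: "ell2 \<Rightarrow> ell2 \<Rightarrow> ell2" is "\<lambda>f g j. f j + g j"
  unfolding ell2_iff_square_integrable by (rule square_integrable_add)

lift_definition minus_ell2 :: "ell2 \<Rightarrow> ell2 \<Rightarrow> ell2" is "\<lambda>f g j. f j - g j"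
  unfolding ell2_iff_square_integrable by (rule square_integrable_diff)

lift_definition uminus_ell2 :: "ell2 \<Rightarrow> ell2" is "\<lambda>f j. - f j"
  unfolding ell2_iff_square_integrable by (rule square_integrable_minus)

lift_definition scaleR_ell2 :: "real \<Rightarrow> ell2 \<Rightarrow> ell2" is "\<lambda>c f j. c * f j"
  unfolding ell2_iff_square_integrable by (rule square_integrable_scale)

lift_definition inner_ell2 :: "ell2 \<Rightarrow> ell2 \<Rightarrow> real" is "\<lambda>f g. \<Sum>j. f j * g j" .

definition norm_ell2 :: "ell2 \<Rightarrow> real" where "norm_ell2 x = sqrt (inner x x)"
definition dist_ell2 :: "ell2 \<Rightarrow> ell2 \<Rightarrow> real" where "dist_ell2 x y = norm (x - y)"
definition sgn_ell2 :: "ell2 \<Rightarrow> ell2" where "sgn_ell2 x = inverse (norm x) *\<^sub>R x"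
definition uniformity_ell2 :: "(ell2 \<times> ell2) filter"
  where "uniformity_ell2 = (INF e\<in>{0 <..}. principal {(x, y). dist x y < e})"
definition open_ell2 :: "ell2 set \<Rightarrow> bool"
  where "open_ell2 U \<longleftrightarrow> (\<forall>x\<in>U. eventually (\<lambda>(x', y). x' = x \<longrightarrow> y \<in> U) uniformity)"

instance
proof
  fix x y z :: ell2 and a b :: real and U :: "ell2 set"
  show "x + y + z = x + (y + z)" "x + y = y + x" "0 + x = x" "- x + x = 0" "x - y = x + - y"
    by (transfer; simp add: algebra_simps)+
  show "a *\<^sub>R (x + y) = a *\<^sub>R x + a *\<^sub>R y" "(a + b) *\<^sub>R x = a *\<^sub>R x + b *\<^sub>R x"
    "a *\<^sub>R b *\<^sub>R x = (a * b) *\<^sub>R x" "1 *\<^sub>R x = x"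
    by (transfer; simp add: algebra_simps)+
  show "inner x y = inner y x"
    by transfer (simp add: mult.commute)
  show "inner (x + y) z = inner x z + inner y z"
    by transfer (simp add: distrib_right suminf_add ell2_summable_mult)
  show "inner (a *\<^sub>R x) y = a * inner x y"
    by transfer (simp add: mult.assoc suminf_mult ell2_summable_mult)
  show "0 \<le> inner x x"
    by transfer (simp add: suminf_nonneg power2_eq_square)
  show "inner x x = 0 \<longleftrightarrow> x = 0"
    by transfer (auto simp: suminf_eq_zero_iff power2_eq_square fun_eq_iff)
qed (simp_all add: norm_ell2_def dist_ell2_def sgn_ell2_def uniformity_ell2_def open_ell2_def)

end



lemma has_integral_sin_weighted:
  assumes "n > 0"
  shows "((\<lambda>t. (pi - t) * sin (real n * t)) has_integral (2 * pi / real n)) {0..2*pi}"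
proof -
  define F where "F = (\<lambda>t. - (pi - t) * cos (real n * t) / real n - sin (real n * t) / (real n)\<^sup>2)"
  have "((\<lambda>t. (pi - t) * sin (real n * t)) has_integral (F (2*pi) - F 0)) {0..2*pi}"
  proof (rule fundamental_theorem_of_calculus)
    fix t :: real
    have "(F has_real_derivative (pi - t) * sin (real n * t)) (at t within {0..2*pi})"
      unfolding F_def using assms
      by (auto intro!: derivative_eq_intros simp: field_simps power2_eq_square)
    then show "(F has_vector_derivative (pi - t) * sin (real n * t)) (at t within {0..2*pi})"
      by (simp add: has_real_derivative_iff_has_vector_derivative)
  qed simp
  moreover have "cos (real n * (2 * pi)) = 1" "sin (real n * (2 * pi)) = 0"
    using cos_int_2pin[of "int n"] sin_int_2pin[of "int n"] by (simp_all add: mult_ac)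
  ultimately show ?thesis using assms by (simp add: F_def field_simps)
qed

lemma has_integral_cos_diff:
  "((\<lambda>t. cos ((real j - real k) * t)) has_integral (if j = k then 2 * pi else 0)) {0..2*pi}"
proof (cases "j = k")
  case True
  then show ?thesis using has_integral_const_real[of "1::real" 0 "2*pi"] by simp
next
  case False
  define m where "m = real j - real k"
  have m: "m \<noteq> 0" using False by (simp add: m_def)
  have "((\<lambda>t. cos (m * t)) has_integral (sin (m * (2*pi)) / m - sin (m * 0) / m)) {0..2*pi}"
  proof (rule fundamental_theorem_of_calculus)
    fix t :: real
    have "((\<lambda>t. sin (m * t) / m) has_real_derivative cos (m * t)) (at t within {0..2*pi})"
      using m by (auto intro!: derivative_eq_intros)
    then show "((\<lambda>t. sin (m * t) / m) has_vector_derivative cos (m * t)) (at t within {0..2*pi})"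
      by (simp add: has_real_derivative_iff_has_vector_derivative)
  qed simp
  moreover have "sin (m * (2 * pi)) = 0"
    using sin_int_2pin[of "int j - int k"] by (simp add: m_def mult_ac)
  ultimately show ?thesis using False by (simp add: m_def)
qed

lemma Hilbert_inequality:
  fixes a :: "nat \<Rightarrow> real"
  shows "(\<Sum>j<N. \<Sum>k<N. a j * a k / real (j + k + 1)) \<le> pi * (\<Sum>j<N. (a j)\<^sup>2)"
proof -
  define u v where "u = (\<lambda>t. \<Sum>j<N. a j * cos ((real j + 1/2) * t))"
    and "v = (\<lambda>t. \<Sum>j<N. a j * sin ((real j + 1/2) * t))"
  define S where "S = (\<Sum>j<N. \<Sum>k<N. a j * a k / real (j + k + 1))"
  have uv: "2 * (u t * v t) = (\<Sum>j<N. \<Sum>k<N. a j * a k * sin (real (j + k + 1) * t))" for t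
  proof -
    have "(\<Sum>j<N. \<Sum>k<N. a j * a k * sin (real (j + k + 1) * t)) =
      (\<Sum>j<N. \<Sum>k<N. (a j * sin ((real j + 1/2) * t)) * (a k * cos ((real k + 1/2) * t)) +
        (a j * cos ((real j + 1/2) * t)) * (a k * sin ((real k + 1/2) * t)))"
    proof (intro sum.cong refl)
      fix j k
      have "real (j + k + 1) * t = (real j + 1/2) * t + (real k + 1/2) * t"
        by (simp add: algebra_simps)
      then show "a j * a k * sin (real (j + k + 1) * t) =
        (a j * sin ((real j + 1/2) * t)) * (a k * cos ((real k + 1/2) * t)) +
        (a j * cos ((real j + 1/2) * t)) * (a k * sin ((real k + 1/2) * t))"
        by (simp only: sin_add) (simp add: algebra_simps)
    qed
    also have "\<dots> = v t * u t + u t * v t"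
      by (simp add: sum.distrib u_def v_def sum_product)
    finally show ?thesis by simp
  qed
  have uu: "(u t)\<^sup>2 + (v t)\<^sup>2 = (\<Sum>j<N. \<Sum>k<N. a j * a k * cos ((real j - real k) * t))" for t
  proof -
    have "(\<Sum>j<N. \<Sum>k<N. a j * a k * cos ((real j - real k) * t)) =
      (\<Sum>j<N. \<Sum>k<N. (a j * cos ((real j + 1/2) * t)) * (a k * cos ((real k + 1/2) * t)) +
        (a j * sin ((real j + 1/2) * t)) * (a k * sin ((real k + 1/2) * t)))"
    proof (intro sum.cong refl)
      fix j k
      have "(real j - real k) * t = (real j + 1/2) * t - (real k + 1/2) * t"
        by (simp add: algebra_simps)
      then show "a j * a k * cos ((real j - real k) * t) =
        (a j * cos ((real j + 1/2) * t)) * (a k * cos ((real k + 1/2) * t)) +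
        (a j * sin ((real j + 1/2) * t)) * (a k * sin ((real k + 1/2) * t))"
        by (simp only: cos_diff) (simp add: algebra_simps)
    qed
    also have "\<dots> = u t * u t + v t * v t"
      by (simp add: sum.distrib u_def v_def sum_product)
    finally show ?thesis by (simp add: power2_eq_square)
  qed
  have I1: "((\<lambda>t. (pi - t) * (2 * (u t * v t))) has_integral 2 * pi * S) {0..2*pi}"
  proof -
    have "((\<lambda>t. \<Sum>j<N. \<Sum>k<N. (a j * a k) * ((pi - t) * sin (real (j + k + 1) * t))) has_integral
      (\<Sum>j<N. \<Sum>k<N. (a j * a k) * (2 * pi / real (j + k + 1)))) {0..2*pi}"
      by (intro has_integral_sum finite_lessThan has_integral_mult_right has_integral_sin_weighted) simp
    moreover have "(\<Sum>j<N. \<Sum>k<N. (a j * a k) * (2 * pi / real (j + k + 1))) = 2 * pi * S"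
      unfolding S_def by (simp add: sum_distrib_left algebra_simps)
    moreover have "(\<lambda>t. \<Sum>j<N. \<Sum>k<N. (a j * a k) * ((pi - t) * sin (real (j + k + 1) * t))) =
      (\<lambda>t. (pi - t) * (2 * (u t * v t)))"
      unfolding uv by (simp add: sum_distrib_left mult_ac)
    ultimately show ?thesis by simp
  qed
  have I2: "((\<lambda>t. pi * ((u t)\<^sup>2 + (v t)\<^sup>2)) has_integral pi * (2 * pi * (\<Sum>j<N. (a j)\<^sup>2))) {0..2*pi}"
  proof (rule has_integral_mult_right)
    have "((\<lambda>t. \<Sum>j<N. \<Sum>k<N. (a j * a k) * cos ((real j - real k) * t)) has_integral
      (\<Sum>j<N. \<Sum>k<N. (a j * a k) * (if j = k then 2 * pi else 0))) {0..2*pi}"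
      by (intro has_integral_sum finite_lessThan has_integral_mult_right has_integral_cos_diff)
    moreover have "(\<Sum>j<N. \<Sum>k<N. (a j * a k) * (if j = k then 2 * pi else 0)) = 2 * pi * (\<Sum>j<N. (a j)\<^sup>2)"
      by (simp add: if_distrib sum.delta' sum_distrib_left power2_eq_square mult_ac cong: if_cong)
    ultimately show "((\<lambda>t. (u t)\<^sup>2 + (v t)\<^sup>2) has_integral 2 * pi * (\<Sum>j<N. (a j)\<^sup>2)) {0..2*pi}"
      unfolding uu by simp
  qed
  have "2 * pi * S \<le> pi * (2 * pi * (\<Sum>j<N. (a j)\<^sup>2))"
  proof (rule has_integral_le[OF I1 I2])
    fix t :: real assume t: "t \<in> {0..2*pi}"
    have "(pi - t) * (2 * (u t * v t)) \<le> \<bar>pi - t\<bar> * \<bar>2 * (u t * v t)\<bar>"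
      by (metis abs_ge_self abs_mult)
    also have "\<dots> \<le> pi * ((u t)\<^sup>2 + (v t)\<^sup>2)"
    proof (rule mult_mono)
      show "\<bar>2 * (u t * v t)\<bar> \<le> (u t)\<^sup>2 + (v t)\<^sup>2"
        using sum_squares_bound[of "\<bar>u t\<bar>" "\<bar>v t\<bar>"] by (simp add: abs_mult)
    qed (use t in auto)
    finally show "(pi - t) * (2 * (u t * v t)) \<le> pi * ((u t)\<^sup>2 + (v t)\<^sup>2)" .
  qed
  then have "(2 * pi) * S \<le> (2 * pi) * (pi * (\<Sum>j<N. (a j)\<^sup>2))"
    by (simp add: mult_ac)
  then show ?thesis
    unfolding S_def by (rule mult_left_le_imp_le) simp
qed

lemma has_bochner_integral_unit_interval_power:
  "has_bochner_integral unit_interval (\<lambda>t. t ^ n) (1 / real (n + 1))"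
proof -
  have "has_bochner_integral lborel (\<lambda>t. t ^ n * indicator {0..1} t) (1 ^ Suc n / real (Suc n) - 0 ^ Suc n / real (Suc n))"
    by (rule has_bochner_integral_FTC_Icc_nonneg)
      (auto intro!: derivative_eq_intros continuous_intros simp del: power_Suc)
  then have *: "has_bochner_integral lborel (\<lambda>t. indicator {0..1} t * t ^ n) (1 / real (n + 1))"
    by (simp add: mult.commute)
  have "has_bochner_integral lborel (\<lambda>t. indicator {0<..<1} t * t ^ n) (1 / real (n + 1))"
  proof (rule has_bochner_integralI_AE[OF *])
    show "AE t in lborel. indicator {0..1} t * t ^ n = indicator {0<..<1} t * (t::real) ^ n"
    proof -
      have "AE t in lborel. t \<noteq> (0::real) \<and> t \<noteq> 1"
        using AE_lborel_singleton[of "0::real"] AE_lborel_singleton[of "1::real"] by (rule AE_conjI)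
      then show ?thesis by (rule eventually_mono) (auto simp: indicator_def)
    qed
  qed measurable
  then show ?thesis
    by (subst has_bochner_integral_restrict_space) (auto simp: scaleR_conv_of_real)
qed

lemma unit_interval_measurable: "f \<in> borel_measurable borel \<Longrightarrow> f \<in> borel_measurable unit_interval"
  by (rule measurable_restrict_space1) simp

lemma square_integrable_power: "square_integrable unit_interval (\<lambda>t. t ^ n)"
  unfolding square_integrable_def
  using has_bochner_integral_unit_interval_power[of "n * 2"] unit_interval_measurable[of "\<lambda>t. t ^ n"]
  by (auto simp: has_bochner_integral_iff simp flip: power_mult)

lemma square_integrable_sum:
  assumes "\<And>i. i \<in> A \<Longrightarrow> square_integrable M (f i)"
  shows "square_integrable M (\<lambda>x. \<Sum>i\<in>A. f i x)"
  using assms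
  by (induction A rule: infinite_finite_induct) (auto intro: square_integrable_zero square_integrable_add)

lemma moments_square_summable:
  assumes x: "square_integrable unit_interval x"
  shows "summable (\<lambda>j. (\<integral>t. x t * t ^ j \<partial>unit_interval)\<^sup>2)"
    and "(\<Sum>j. (\<integral>t. x t * t ^ j \<partial>unit_interval)\<^sup>2) \<le> pi * (\<integral>t. (x t)\<^sup>2 \<partial>unit_interval)"
proof -
  define m where "m = (\<lambda>j. \<integral>t. x t * t ^ j \<partial>unit_interval)"
  define X where "X = (\<integral>t. (x t)\<^sup>2 \<partial>unit_interval)"
  have bound: "(\<Sum>j<N. (m j)\<^sup>2) \<le> pi * X" for N
  proof -
    define S where "S = (\<Sum>j<N. (m j)\<^sup>2)"
    define p where "p = (\<lambda>t::real. \<Sum>j<N. m j * t ^ j)"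
    have sp: "square_integrable unit_interval p"
      unfolding p_def by (intro square_integrable_sum square_integrable_scale square_integrable_power)
    have "(\<integral>t. x t * p t \<partial>unit_interval) = (\<integral>t. (\<Sum>j<N. m j * (x t * t ^ j)) \<partial>unit_interval)"
      by (simp add: p_def sum_distrib_left mult_ac)
    also have "\<dots> = S"
      using square_integrable_mult[OF x square_integrable_power]
      by (simp add: S_def m_def power2_eq_square)
    finally have xp: "(\<integral>t. x t * p t \<partial>unit_interval) = S" .
    have "(\<integral>t. (p t)\<^sup>2 \<partial>unit_interval) = (\<integral>t. (\<Sum>j<N. \<Sum>k<N. m j * m k * t ^ (j + k)) \<partial>unit_interval)"
      by (simp add: p_def power2_eq_square sum_product power_add mult_ac)
    also have "\<dots> = (\<Sum>j<N. \<Sum>k<N. m j * m k / real (j + k + 1))"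
      using has_bochner_integral_unit_interval_power
      by (simp add: has_bochner_integral_iff)
    also have "\<dots> \<le> pi * S"
      unfolding S_def by (rule Hilbert_inequality)
    finally have pp: "(\<integral>t. (p t)\<^sup>2 \<partial>unit_interval) \<le> pi * S" .
    have "S\<^sup>2 \<le> X * (\<integral>t. (p t)\<^sup>2 \<partial>unit_interval)"
      using square_integrable_Cauchy_Schwarz[OF x sp] by (simp add: xp X_def)
    also have "\<dots> \<le> X * (pi * S)"
      by (rule mult_left_mono[OF pp]) (simp add: X_def)
    finally have "S * S \<le> (pi * X) * S" by (simp add: power2_eq_square mult_ac)
    moreover have "0 \<le> S" "0 \<le> pi * X" by (simp_all add: S_def X_def sum_nonneg)
    ultimately have "S \<le> pi * X"
      by (metis mult_right_le_imp_le order_le_less)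
    then show ?thesis by (simp add: S_def)
  qed
  show "summable (\<lambda>j. (\<integral>t. x t * t ^ j \<partial>unit_interval)\<^sup>2)"
    using bound by (intro summableI_nonneg_bounded[of _ "pi * X"]) (auto simp: m_def)
  then show "(\<Sum>j. (\<integral>t. x t * t ^ j \<partial>unit_interval)\<^sup>2) \<le> pi * (\<integral>t. (x t)\<^sup>2 \<partial>unit_interval)"
    using bound by (intro suminf_le_const) (auto simp: m_def X_def)
qed

lemma L2_limit:
  fixes F :: "nat \<Rightarrow> 'a \<Rightarrow> real"
  assumes F: "\<And>n. square_integrable M (F n)"
    and Cauchy: "\<And>e. e > 0 \<Longrightarrow> \<exists>N. \<forall>m\<ge>N. \<forall>n\<ge>N. (\<integral>x. (F m x - F n x)\<^sup>2 \<partial>M) \<le> e"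
    and r: "strict_mono r" and f: "f \<in> borel_measurable M"
    and lim: "AE x in M. (\<lambda>k. F (r k) x) \<longlonglongrightarrow> f x"
  shows "square_integrable M f"
    and "\<And>e. e > 0 \<Longrightarrow> \<exists>N. \<forall>n\<ge>N. (\<integral>x. (F n x - f x)\<^sup>2 \<partial>M) \<le> e"
proof -
  have Fm [measurable]: "F n \<in> borel_measurable M" for n
    using F by (simp add: square_integrable_def)
  note f [measurable]
  have bound: "\<exists>N. \<forall>n\<ge>N. (\<integral>\<^sup>+x. ennreal ((F n x - f x)\<^sup>2) \<partial>M) \<le> ennreal e" if "e > 0" for e
  proof -
    obtain N where N: "\<And>m n. m \<ge> N \<Longrightarrow> n \<ge> N \<Longrightarrow> (\<integral>x. (F m x - F n x)\<^sup>2 \<partial>M) \<le> e"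
      using Cauchy[OF \<open>e > 0\<close>] by blast
    have "(\<integral>\<^sup>+x. ennreal ((F n x - f x)\<^sup>2) \<partial>M) \<le> ennreal e" if n: "n \<ge> N" for n
    proof -
      have "(\<integral>\<^sup>+x. ennreal ((F n x - f x)\<^sup>2) \<partial>M) =
        (\<integral>\<^sup>+x. liminf (\<lambda>k. ennreal ((F n x - F (r k) x)\<^sup>2)) \<partial>M)"
      proof (rule nn_integral_cong_AE, rule eventually_mono[OF lim])
        fix x assume "(\<lambda>k. F (r k) x) \<longlonglongrightarrow> f x"
        then have "(\<lambda>k. ennreal ((F n x - F (r k) x)\<^sup>2)) \<longlonglongrightarrow> ennreal ((F n x - f x)\<^sup>2)"
          by (intro tendsto_intros)
        then show "ennreal ((F n x - f x)\<^sup>2) = liminf (\<lambda>k. ennreal ((F n x - F (r k) x)\<^sup>2))"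
          by (metis lim_imp_Liminf trivial_limit_sequentially)
      qed
      also have "\<dots> \<le> liminf (\<lambda>k. \<integral>\<^sup>+x. ennreal ((F n x - F (r k) x)\<^sup>2) \<partial>M)"
        by (rule nn_integral_liminf) measurable
      also have "\<dots> \<le> limsup (\<lambda>k. \<integral>\<^sup>+x. ennreal ((F n x - F (r k) x)\<^sup>2) \<partial>M)"
        by (rule Liminf_le_Limsup) simp
      also have "\<dots> \<le> ennreal e"
      proof (rule Limsup_bounded, rule eventually_sequentiallyI[of N])
        fix k assume "N \<le> k"
        then have "r k \<ge> N" using strict_mono_imp_increasing[OF r, of k] by linarith
        have "(\<integral>\<^sup>+x. ennreal ((F n x - F (r k) x)\<^sup>2) \<partial>M) = ennreal (\<integral>x. (F n x - F (r k) x)\<^sup>2 \<partial>M)"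
          using square_integrable_diff[OF F F, of n "r k"]
          by (intro nn_integral_eq_integral) (auto simp: square_integrable_def)
        then show "(\<integral>\<^sup>+x. ennreal ((F n x - F (r k) x)\<^sup>2) \<partial>M) \<le> ennreal e"
          using N[OF n \<open>r k \<ge> N\<close>] by (simp add: ennreal_leI)
      qed
      finally show ?thesis .
    qed
    then show ?thesis by blast
  qed
  have sq: "square_integrable M (\<lambda>x. F n x - f x)"
    if "(\<integral>\<^sup>+x. ennreal ((F n x - f x)\<^sup>2) \<partial>M) \<le> ennreal e" for n e
    using that unfolding square_integrable_def
    by (auto intro!: integrableI_nonneg intro: le_less_trans)
  obtain N where "\<forall>n\<ge>N. (\<integral>\<^sup>+x. ennreal ((F n x - f x)\<^sup>2) \<partial>M) \<le> ennreal 1"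
    using bound[of 1] by auto
  then have "square_integrable M (\<lambda>x. F N x - f x)"
    using sq[of N 1] by auto
  from square_integrable_diff[OF F[of N] this]
  have "square_integrable M (\<lambda>x. F N x - (F N x - f x))" .
  moreover have "(\<lambda>x. F N x - (F N x - f x)) = f" by (simp add: fun_eq_iff)
  ultimately show "square_integrable M f" by metis
  fix e :: real assume "e > 0"
  obtain N where N: "\<And>n. n \<ge> N \<Longrightarrow> (\<integral>\<^sup>+x. ennreal ((F n x - f x)\<^sup>2) \<partial>M) \<le> ennreal e"
    using bound[OF \<open>e > 0\<close>] by auto
  have "(\<integral>x. (F n x - f x)\<^sup>2 \<partial>M) \<le> e" if "n \<ge> N" for n
  proof -
    have "integrable M (\<lambda>x. (F n x - f x)\<^sup>2)"
      using sq[OF N[OF that]] by (simp add: square_integrable_def)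
    then show ?thesis
      using N[OF that] \<open>e > 0\<close> by (subst (asm) nn_integral_eq_integral) auto
  qed
  then show "\<exists>N. \<forall>n\<ge>N. (\<integral>x. (F n x - f x)\<^sup>2 \<partial>M) \<le> e" by blast
qed

lemma L2_Cauchy_AE_subseq:
  fixes F :: "nat \<Rightarrow> 'a \<Rightarrow> real"
  assumes M: "finite_measure M" and F: "\<And>n. square_integrable M (F n)"
    and Cauchy: "\<And>e. e > 0 \<Longrightarrow> \<exists>N. \<forall>m\<ge>N. \<forall>n\<ge>N. (\<integral>x. (F m x - F n x)\<^sup>2 \<partial>M) \<le> e"
  obtains r f where "strict_mono r" "f \<in> borel_measurable M"
    "AE x in M. (\<lambda>k. F (r k) x) \<longlonglongrightarrow> f x"
proof -
  have Fm [measurable]: "F n \<in> borel_measurable M" for n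
    using F by (simp add: square_integrable_def)
  have "\<exists>N. \<forall>m\<ge>N. \<forall>n\<ge>N. (\<integral>x. (F m x - F n x)\<^sup>2 \<partial>M) \<le> (1/4) ^ k" for k :: nat
    by (rule Cauchy) simp
  then obtain N where N: "\<And>k m n. m \<ge> N k \<Longrightarrow> n \<ge> N k \<Longrightarrow> (\<integral>x. (F m x - F n x)\<^sup>2 \<partial>M) \<le> (1/4) ^ k"
    by metis
  define r where "r = rec_nat (N 0) (\<lambda>k p. max (Suc p) (N (Suc k)))"
  have r0: "r 0 = N 0" and rS: "r (Suc k) = max (Suc (r k)) (N (Suc k))" for k
    by (simp_all add: r_def)
  have r: "strict_mono r"
    by (rule strict_mono_Suc_iff[THEN iffD2]) (simp add: rS less_max_iff_disj)
  have rN: "r k \<ge> N k" for k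
    by (cases k) (simp_all add: r0 rS)
  define d where "d = (\<lambda>k x. F (r (Suc k)) x - F (r k) x)"
  have d: "square_integrable M (d k)" for k
    unfolding d_def by (intro square_integrable_diff F)
  have dm [measurable]: "d k \<in> borel_measurable M" for k
    using d by (simp add: square_integrable_def)
  define C where "C = sqrt (measure M (space M))"
  have one: "square_integrable M (\<lambda>x. 1)"
    using M by (simp add: square_integrable_def finite_measure.integrable_const)
  have int_d: "integrable M (\<lambda>x. \<bar>d k x\<bar>)" for k
    using square_integrable_mult[OF d one] by simp
  have abs_d: "(\<integral>x. \<bar>d k x\<bar> \<partial>M) \<le> C * (1/2) ^ k" for k
  proof -
    have "square_integrable M (\<lambda>x. \<bar>d k x\<bar>)" using d by (simp add: square_integrable_def)
    from square_integrable_Cauchy_Schwarz[OF this one]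
    have "(\<integral>x. \<bar>d k x\<bar> \<partial>M)\<^sup>2 \<le> (\<integral>x. (d k x)\<^sup>2 \<partial>M) * measure M (space M)"
      using M by (simp add: finite_measure.integrable_const)
    also have "\<dots> \<le> (1/4) ^ k * measure M (space M)"
    proof (rule mult_right_mono)
      have "r (Suc k) \<ge> N k" "r k \<ge> N k" using rN[of k] by (auto simp: rS)
      then show "(\<integral>x. (d k x)\<^sup>2 \<partial>M) \<le> (1/4) ^ k" unfolding d_def by (rule N)
    qed simp
    also have "\<dots> = (C * (1/2) ^ k)\<^sup>2"
      by (simp add: C_def power_mult_distrib mult.commute flip: power_mult)
        (simp add: power_mult power2_eq_square mult.commute[of k 2])
    finally show ?thesis by (rule power2_le_imp_le) (simp add: C_def)
  qed
  have "(\<integral>\<^sup>+x. (\<Sum>k. ennreal \<bar>d k x\<bar>) \<partial>M) = (\<Sum>k. \<integral>\<^sup>+x. ennreal \<bar>d k x\<bar> \<partial>M)"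
    by (rule nn_integral_suminf) measurable
  also have "\<dots> = (\<Sum>k. ennreal (\<integral>x. \<bar>d k x\<bar> \<partial>M))"
    using int_d by (simp add: nn_integral_eq_integral)
  also have "\<dots> \<le> (\<Sum>k. ennreal (C * (1/2) ^ k))"
    by (intro suminf_le summableI ennreal_leI abs_d)
  also have "\<dots> = ennreal (\<Sum>k. C * (1/2) ^ k)"
    by (intro suminf_ennreal2) (auto simp: C_def intro!: summable_mult summable_geometric)
  also have "\<dots> < \<infinity>" by simp
  finally have "(\<integral>\<^sup>+x. (\<Sum>k. ennreal \<bar>d k x\<bar>) \<partial>M) \<noteq> \<infinity>" by simp
  then have fin: "AE x in M. (\<Sum>k. ennreal \<bar>d k x\<bar>) \<noteq> \<infinity>"
    by (intro nn_integral_noteq_infinite) auto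
  define f where "f = (\<lambda>x. lim (\<lambda>k. F (r k) x))"
  have "AE x in M. (\<lambda>k. F (r k) x) \<longlonglongrightarrow> f x"
    using fin
  proof (rule eventually_mono)
    fix x assume "(\<Sum>k. ennreal \<bar>d k x\<bar>) \<noteq> \<infinity>"
    then have "summable (\<lambda>k. \<bar>d k x\<bar>)"
      by (intro summable_suminf_not_top) auto
    then have "summable (\<lambda>k. d k x)" by (rule summable_rabs_cancel)
    then have "(\<lambda>n. \<Sum>k<n. d k x) \<longlonglongrightarrow> (\<Sum>k. d k x)" by (rule summable_LIMSEQ)
    moreover have "(\<Sum>k<n. d k x) = F (r n) x - F (r 0) x" for n
      unfolding d_def by (rule sum_lessThan_telescope)
    ultimately have "(\<lambda>n. F (r n) x - F (r 0) x + F (r 0) x) \<longlonglongrightarrow> (\<Sum>k. d k x) + F (r 0) x"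
      by (intro tendsto_add) auto
    then have "convergent (\<lambda>n. F (r n) x)" by (auto simp: convergent_def)
    then show "(\<lambda>k. F (r k) x) \<longlonglongrightarrow> f x" by (simp add: f_def convergent_LIMSEQ_iff)
  qed
  moreover have "f \<in> borel_measurable M"
    unfolding f_def by (rule borel_measurable_lim_metric) measurable
  ultimately show ?thesis using r that by blast
qed


lemma L2_cases:
  obtains f where "square_integrable unit_interval f" "x = abs_L2 f"
  by (induct x rule: L2.abs_induct) auto

lemma L2_norm_diff:
  assumes "square_integrable unit_interval f" "square_integrable unit_interval g"
  shows "(norm (abs_L2 f - abs_L2 g))\<^sup>2 = (\<integral>t. (f t - g t)\<^sup>2 \<partial>unit_interval)"
  using assms square_integrable_diff[OF assms]
  unfolding power2_norm_eq_inner by (simp add: minus_L2.abs_eq inner_L2.abs_eq power2_eq_square)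

lemma finite_measure_unit_interval: "finite_measure unit_interval"
  by (rule finite_measureI) (simp add: space_restrict_space emeasure_restrict_space)

lemma Cauchy_norm_power2:
  fixes X :: "nat \<Rightarrow> 'a::real_normed_vector"
  assumes "Cauchy X" "e > 0"
  shows "\<exists>N. \<forall>m\<ge>N. \<forall>n\<ge>N. (norm (X m - X n))\<^sup>2 \<le> e"
proof -
  have "sqrt e > 0" using \<open>e > 0\<close> by simp
  then obtain N where N: "\<And>m n. m \<ge> N \<Longrightarrow> n \<ge> N \<Longrightarrow> norm (X m - X n) < sqrt e"
    using CauchyD[OF \<open>Cauchy X\<close>] by blast
  have "(norm (X m - X n))\<^sup>2 \<le> e" if "m \<ge> N" "n \<ge> N" for m n
    using power_mono[OF less_imp_le[OF N[OF that]], of 2] \<open>e > 0\<close> by simp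
  then show ?thesis by blast
qed

lemma LIMSEQ_norm_power2I:
  fixes X :: "nat \<Rightarrow> 'a::real_normed_vector"
  assumes "\<And>e. e > 0 \<Longrightarrow> \<exists>N. \<forall>n\<ge>N. (norm (X n - L))\<^sup>2 \<le> e"
  shows "X \<longlonglongrightarrow> L"
proof (rule LIMSEQ_I)
  fix e :: real assume "e > 0"
  then have "(e/2)\<^sup>2 > 0" by simp
  from assms[OF this] obtain N where N: "\<And>n. n \<ge> N \<Longrightarrow> (norm (X n - L))\<^sup>2 \<le> (e/2)\<^sup>2" by blast
  have "norm (X n - L) < e" if "n \<ge> N" for n
    using power2_le_imp_le[OF N[OF that]] \<open>e > 0\<close> by simp
  then show "\<exists>N. \<forall>n\<ge>N. norm (X n - L) < e" by blast
qed

instance L2 :: complete_space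
proof
  fix X :: "nat \<Rightarrow> L2" assume X: "Cauchy X"
  have "\<forall>n. \<exists>f. square_integrable unit_interval f \<and> X n = abs_L2 f"
    by (metis L2_cases)
  then obtain F where F: "\<And>n. square_integrable unit_interval (F n)" and XF: "X = (\<lambda>n. abs_L2 (F n))"
    by metis
  have C: "\<exists>N. \<forall>m\<ge>N. \<forall>n\<ge>N. (\<integral>t. (F m t - F n t)\<^sup>2 \<partial>unit_interval) \<le> e" if "e > 0" for e
    using Cauchy_norm_power2[OF X that] by (simp add: XF L2_norm_diff F)
  obtain r f where rf: "strict_mono r" "f \<in> borel_measurable unit_interval"
    "AE t in unit_interval. (\<lambda>k. F (r k) t) \<longlonglongrightarrow> f t"
    by (rule L2_Cauchy_AE_subseq[OF finite_measure_unit_interval F C])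
  note lim = L2_limit[OF F C rf]
  have "X \<longlonglongrightarrow> abs_L2 f"
    using lim by (intro LIMSEQ_norm_power2I) (simp add: XF L2_norm_diff F)
  then show "convergent X" by (auto simp: convergent_def)
qed

instance ell2 :: complete_space
proof
  fix X :: "nat \<Rightarrow> ell2" assume X: "Cauchy X"
  let ?M = "count_space UNIV :: nat measure"
  have sq: "square_integrable ?M (ell2_nth x)" for x
    using ell2_nth[of x] by (simp flip: ell2_iff_square_integrable)
  have norm_diff: "(norm (x - y))\<^sup>2 = (\<integral>j. (ell2_nth x j - ell2_nth y j)\<^sup>2 \<partial>?M)" for x y
  proof -
    have "integrable ?M (\<lambda>j. (ell2_nth x j - ell2_nth y j)\<^sup>2)"
      using square_integrable_diff[OF sq sq] by (simp add: square_integrable_def)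
    then show ?thesis
      unfolding power2_norm_eq_inner
      by (simp add: inner_ell2.rep_eq minus_ell2.rep_eq integral_count_space_nat
          power2_eq_square)
  qed
  have nth_le: "\<bar>ell2_nth x j\<bar> \<le> norm x" for x j
  proof -
    have "(\<Sum>i\<in>{j}. (ell2_nth x i)\<^sup>2) \<le> (\<Sum>i. (ell2_nth x i)\<^sup>2)"
      using ell2_nth[of x] by (intro sum_le_suminf) auto
    then have "(ell2_nth x j)\<^sup>2 \<le> (norm x)\<^sup>2"
      unfolding power2_norm_eq_inner by (simp add: inner_ell2.rep_eq power2_eq_square)
    then show ?thesis by (metis abs_le_square_iff abs_norm_cancel)
  qed
  define f where "f = (\<lambda>j. lim (\<lambda>n. ell2_nth (X n) j))"
  have lim: "(\<lambda>n. ell2_nth (X n) j) \<longlonglongrightarrow> f j" for j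
  proof -
    have "Cauchy (\<lambda>n. ell2_nth (X n) j)"
    proof (rule CauchyI)
      fix e :: real assume "e > 0"
      from CauchyD[OF X this] obtain N where N: "\<forall>m\<ge>N. \<forall>n\<ge>N. norm (X m - X n) < e" by blast
      have "norm (ell2_nth (X m) j - ell2_nth (X n) j) < e" if "m \<ge> N" "n \<ge> N" for m n
        using nth_le[of "X m - X n" j] N that by (force simp: minus_ell2.rep_eq)
      then show "\<exists>N. \<forall>m\<ge>N. \<forall>n\<ge>N. norm (ell2_nth (X m) j - ell2_nth (X n) j) < e" by blast
    qed
    then show ?thesis by (simp add: f_def Cauchy_convergent_iff convergent_LIMSEQ_iff)
  qed
  have C: "\<exists>N. \<forall>m\<ge>N. \<forall>n\<ge>N. (\<integral>j. (ell2_nth (X m) j - ell2_nth (X n) j)\<^sup>2 \<partial>?M) \<le> e" if "e > 0" for e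
    using Cauchy_norm_power2[OF X that] by (simp add: norm_diff)
  have AE: "AE j in ?M. (\<lambda>k. ell2_nth (X (id k)) j) \<longlonglongrightarrow> f j"
    using lim by simp
  have limit: "square_integrable ?M f"
    "\<And>e. e > 0 \<Longrightarrow> \<exists>N. \<forall>n\<ge>N. (\<integral>j. (ell2_nth (X n) j - f j)\<^sup>2 \<partial>?M) \<le> e"
    using L2_limit[OF sq C _ _ AE] by (auto simp: strict_mono_def)
  have "ell2_nth (Abs_ell2 f) = f"
    using limit(1) by (intro Abs_ell2_inverse) (simp add: ell2_iff_square_integrable)
  then have "X \<longlonglongrightarrow> Abs_ell2 f"
    using limit(2) by (intro LIMSEQ_norm_power2I) (simp add: norm_diff)
  then show "convergent X" by (auto simp: convergent_def)
qed



lemma square_integrable_unit_interval_iff: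
  "square_integrable unit_interval f \<longleftrightarrow> square_integrable lborel (\<lambda>t. indicator {0<..<1} t * f t)"
proof -
  have "(\<lambda>t. indicator {0<..<1} t * (f t)\<^sup>2) = (\<lambda>t. (indicator {0<..<1} t * f t)\<^sup>2)"
    by (auto simp: indicator_def)
  then show ?thesis
    by (simp add: square_integrable_def borel_measurable_restrict_space_iff integrable_restrict_space)
qed

lemma integral_unit_interval_power2:
  fixes f :: "real \<Rightarrow> real"
  shows "(\<integral>t. (f t)\<^sup>2 \<partial>unit_interval) = (\<integral>t. (indicator {0<..<1} t * f t)\<^sup>2 \<partial>lborel)"
proof -
  have "(\<lambda>t. indicator {0<..<1} t * (f t)\<^sup>2) = (\<lambda>t. (indicator {0<..<1} t * f t)\<^sup>2)"
    by (auto simp: indicator_def)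
  then show ?thesis by (simp add: integral_restrict_space)
qed

lemma nn_integral_inverse_sqrt:
  assumes "0 < s"
  shows "(\<integral>\<^sup>+t. ennreal (indicator {0<..<s} t * (2 / sqrt t)) \<partial>lborel) = ennreal (4 * sqrt s)"
proof -
  have "((\<lambda>t. 2 / sqrt t) has_integral (4 * sqrt s - 4 * sqrt 0)) {0..s}"
  proof (rule fundamental_theorem_of_calculus_interior)
    fix t assume "t \<in> {0<..<s}"
    then have "((\<lambda>t. 4 * sqrt t) has_real_derivative 2 / sqrt t) (at t)"
      by (auto intro!: derivative_eq_intros simp: field_simps)
    then show "((\<lambda>t. 4 * sqrt t) has_vector_derivative 2 / sqrt t) (at t)"
      by (simp add: has_real_derivative_iff_has_vector_derivative)
  qed (use assms in \<open>auto intro!: continuous_intros\<close>)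
  then have "((\<lambda>t. 2 / sqrt t) has_integral 4 * sqrt s) {0<..<s}"
    by (simp add: has_integral_Icc_iff_Ioo)
  then show ?thesis
    by (intro nn_integral_has_integral_lebesgue) auto
qed

lemma integrable_sqrt_tail:
  assumes "0 < t" "t < 1"
  shows "integrable lborel (\<lambda>s. indicator {t<..<1} s * (sqrt s / s\<^sup>2))"
    and "(\<integral>s. indicator {t<..<1} s * (sqrt s / s\<^sup>2) \<partial>lborel) \<le> 2 / sqrt t"
proof -
  have "has_bochner_integral lborel (\<lambda>s. (sqrt s / s\<^sup>2) * indicator {t..1} s) (- 2 / sqrt 1 - (- 2 / sqrt t))"
  proof (rule has_bochner_integral_FTC_Icc_nonneg)
    fix s assume "s \<in> {t..1}"
    then have "s > 0" using assms by auto
    then show "((\<lambda>s. - 2 / sqrt s) has_real_derivative sqrt s / s\<^sup>2) (at s)"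
      by (auto intro!: derivative_eq_intros simp: field_simps power2_eq_square)
    show "0 \<le> sqrt s / s\<^sup>2" using \<open>s > 0\<close> by simp
  qed (use assms in auto)
  then have *: "has_bochner_integral lborel (\<lambda>s. indicator {t..1} s * (sqrt s / s\<^sup>2)) (2 / sqrt t - 2)"
    by (simp add: mult.commute)
  have "has_bochner_integral lborel (\<lambda>s. indicator {t<..<1} s * (sqrt s / s\<^sup>2)) (2 / sqrt t - 2)"
  proof (rule has_bochner_integralI_AE[OF *])
    have "AE s in lborel. s \<noteq> t \<and> s \<noteq> 1"
      using AE_lborel_singleton[of t] AE_lborel_singleton[of "1::real"] by (rule AE_conjI)
    then show "AE s in lborel. indicator {t..1} s * (sqrt s / s\<^sup>2) = indicator {t<..<1} s * (sqrt s / s\<^sup>2)"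
      by (rule eventually_mono) (auto simp: indicator_def)
  qed measurable
  then show "integrable lborel (\<lambda>s. indicator {t<..<1} s * (sqrt s / s\<^sup>2))"
    "(\<integral>s. indicator {t<..<1} s * (sqrt s / s\<^sup>2) \<partial>lborel) \<le> 2 / sqrt t"
    by (simp_all add: has_bochner_integral_iff)
qed

lemma Hardy_inequality:
  assumes x: "square_integrable unit_interval x"
  shows "square_integrable unit_interval (\<lambda>t. LBINT s:{t<..<1}. x s / s)"
    and "(\<integral>t. (LBINT s:{t<..<1}. x s / s)\<^sup>2 \<partial>unit_interval) \<le> 4 * (\<integral>t. (x t)\<^sup>2 \<partial>unit_interval)"
proof -
  define X where "X = (\<lambda>t. indicator {0<..<1} t * x t)"
  have X: "square_integrable lborel X"
    using x unfolding X_def by (simp add: square_integrable_unit_interval_iff)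
  then have Xm [measurable]: "X \<in> borel_measurable borel" and XI: "integrable lborel (\<lambda>t. (X t)\<^sup>2)"
    by (auto simp: square_integrable_def)
  have Xx: "(\<integral>t. (X t)\<^sup>2 \<partial>lborel) = (\<integral>t. (x t)\<^sup>2 \<partial>unit_interval)"
    by (simp add: X_def integral_unit_interval_power2)
  define y where "y = (\<lambda>t. LBINT s:{t<..<1}. x s / s)"
  define Y where "Y = (\<lambda>t. indicator {0<..<1} t * (\<integral>s. indicator {t<..<1} s * (X s / s) \<partial>lborel))"
  have Y: "Y = (\<lambda>t. indicator {0<..<1} t * y t)"
    unfolding Y_def y_def X_def set_lebesgue_integral_def
    by (auto simp: fun_eq_iff indicator_def intro!: Bochner_Integration.integral_cong)
  have ind: "indicator {t<..<1} s = (if t < s \<and> s < 1 then 1 else (0::real))" for s t :: real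
    by (simp add: indicator_def)
  have Ym [measurable]: "Y \<in> borel_measurable borel"
    unfolding Y_def ind by measurable
  have pt: "ennreal ((Y t)\<^sup>2) \<le>
      (\<integral>\<^sup>+s. ennreal (indicator {0<..<1} t * (2 / sqrt t) * (indicator {t<..<1} s * ((X s)\<^sup>2 / sqrt s))) \<partial>lborel)" for t
  proof (cases "0 < t \<and> t < 1")
    case True
    define f where "f = (\<lambda>s. indicator {t<..<1} s * (X s / sqrt (sqrt s)))"
    define g where "g = (\<lambda>s. indicator {t<..<1} s * (sqrt (sqrt s) / s))"
    have f2: "(f s)\<^sup>2 = indicator {t<..<1} s * ((X s)\<^sup>2 / sqrt s)" for s
      using True by (auto simp: f_def indicator_def power_divide)
    have g2: "(g s)\<^sup>2 = indicator {t<..<1} s * (sqrt s / s\<^sup>2)" for s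
      using True by (auto simp: g_def indicator_def power_divide)
    have fg: "f s * g s = indicator {t<..<1} s * (X s / s)" for s
      using True by (auto simp: f_def g_def indicator_def)
    have g: "square_integrable lborel g"
      unfolding square_integrable_def g2 using True integrable_sqrt_tail(1)[of t]
      by (simp add: g_def)
    have If: "integrable lborel (\<lambda>s. indicator {t<..<1} s * ((X s)\<^sup>2 / sqrt s))"
    proof (rule Bochner_Integration.integrable_bound)
      show "integrable lborel (\<lambda>s. (X s)\<^sup>2 / sqrt t)" using XI by simp
      show "AE s in lborel. norm (indicator {t<..<1} s * ((X s)\<^sup>2 / sqrt s)) \<le> norm ((X s)\<^sup>2 / sqrt t)"
        using True by (intro AE_I2) (auto simp: indicator_def intro!: divide_left_mono)
    qed measurable
    then have f: "square_integrable lborel f"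
      unfolding square_integrable_def f2 by (simp add: f_def)
    have "(Y t)\<^sup>2 \<le> (\<integral>s. indicator {t<..<1} s * ((X s)\<^sup>2 / sqrt s) \<partial>lborel) *
        (\<integral>s. indicator {t<..<1} s * (sqrt s / s\<^sup>2) \<partial>lborel)"
      using square_integrable_Cauchy_Schwarz[OF f g] True by (simp add: fg f2 g2 Y_def)
    also have "\<dots> \<le> (\<integral>s. indicator {t<..<1} s * ((X s)\<^sup>2 / sqrt s) \<partial>lborel) * (2 / sqrt t)"
      using True
      by (intro mult_left_mono integrable_sqrt_tail integral_nonneg_AE AE_I2) (auto simp: indicator_def)
    also have "\<dots> = (\<integral>s. indicator {0<..<1} t * (2 / sqrt t) * (indicator {t<..<1} s * ((X s)\<^sup>2 / sqrt s)) \<partial>lborel)"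
      using True by (subst integral_mult_right_zero) simp
    finally have "ennreal ((Y t)\<^sup>2) \<le> ennreal \<dots>" by (rule ennreal_leI)
    also have "\<dots> = (\<integral>\<^sup>+s. ennreal (indicator {0<..<1} t * (2 / sqrt t) * (indicator {t<..<1} s * ((X s)\<^sup>2 / sqrt s))) \<partial>lborel)"
      using True If
      by (intro nn_integral_eq_integral[symmetric] integrable_mult_right AE_I2) (auto simp: indicator_def)
    finally show ?thesis .
  next
    case False
    then show ?thesis by (auto simp: Y_def indicator_def)
  qed
  have "(\<integral>\<^sup>+t. ennreal ((Y t)\<^sup>2) \<partial>lborel) \<le> (\<integral>\<^sup>+t. (\<integral>\<^sup>+s. ennreal (indicator {0<..<1} t * (2 / sqrt t) * (indicator {t<..<1} s * ((X s)\<^sup>2 / sqrt s))) \<partial>lborel) \<partial>lborel)"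
    by (intro nn_integral_mono pt)
  also have "\<dots> = (\<integral>\<^sup>+s. (\<integral>\<^sup>+t. ennreal (indicator {0<..<1} t * (2 / sqrt t) * (indicator {t<..<1} s * ((X s)\<^sup>2 / sqrt s))) \<partial>lborel) \<partial>lborel)"
    unfolding ind by (intro lborel_pair.Fubini') measurable
  also have "\<dots> = (\<integral>\<^sup>+s. ennreal (4 * (X s)\<^sup>2) \<partial>lborel)"
  proof (rule nn_integral_cong)
    fix s :: real
    show "(\<integral>\<^sup>+t. ennreal (indicator {0<..<1} t * (2 / sqrt t) * (indicator {t<..<1} s * ((X s)\<^sup>2 / sqrt s))) \<partial>lborel) = ennreal (4 * (X s)\<^sup>2)"
    proof (cases "0 < s \<and> s < 1")
      case True
      have "(\<integral>\<^sup>+t. ennreal (indicator {0<..<1} t * (2 / sqrt t) * (indicator {t<..<1} s * ((X s)\<^sup>2 / sqrt s))) \<partial>lborel)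
        = (\<integral>\<^sup>+t. ennreal ((X s)\<^sup>2 / sqrt s) * ennreal (indicator {0<..<s} t * (2 / sqrt t)) \<partial>lborel)"
        using True by (intro nn_integral_cong) (auto simp: indicator_def mult_ac simp flip: ennreal_mult)
      also have "\<dots> = ennreal ((X s)\<^sup>2 / sqrt s) * ennreal (4 * sqrt s)"
        using True by (subst nn_integral_cmult, measurable) (simp only: nn_integral_inverse_sqrt)
      also have "\<dots> = ennreal (4 * (X s)\<^sup>2)"
        using True by (simp flip: ennreal_mult)
      finally show ?thesis .
    next
      case False
      then show ?thesis by (auto simp: X_def indicator_def)
    qed
  qed
  also have "\<dots> = ennreal (4 * (\<integral>t. (X t)\<^sup>2 \<partial>lborel))"
    using XI by (subst nn_integral_eq_integral) auto
  finally have le: "(\<integral>\<^sup>+t. ennreal ((Y t)\<^sup>2) \<partial>lborel) \<le> ennreal (4 * (\<integral>t. (X t)\<^sup>2 \<partial>lborel))" .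
  then have YI: "integrable lborel (\<lambda>t. (Y t)\<^sup>2)"
    by (intro integrableI_nonneg) (auto intro: le_less_trans)
  then have "square_integrable lborel Y" by (simp add: square_integrable_def)
  then show "square_integrable unit_interval (\<lambda>t. LBINT s:{t<..<1}. x s / s)"
    by (simp add: square_integrable_unit_interval_iff Y y_def)
  have "(\<integral>t. (Y t)\<^sup>2 \<partial>lborel) \<le> 4 * (\<integral>t. (X t)\<^sup>2 \<partial>lborel)"
    using le YI by (simp add: nn_integral_eq_integral)
  moreover have "(\<integral>t. (Y t)\<^sup>2 \<partial>lborel) = (\<integral>t. (y t)\<^sup>2 \<partial>unit_interval)"
    by (simp add: Y integral_unit_interval_power2)
  ultimately show "(\<integral>t. (LBINT s:{t<..<1}. x s / s)\<^sup>2 \<partial>unit_interval) \<le> 4 * (\<integral>t. (x t)\<^sup>2 \<partial>unit_interval)"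
    by (simp add: Xx y_def)
qed


text \<open>
  Coordinates in \<^typ>\<open>ell2\<close> are numbered from 0: coordinate \<open>j\<close> here is the \<open>(j + 1)\<close>-st entry of a
  sequence numbered from 1. Hence the exponent \<open>j\<close> in \<open>H\<close> and the divisor \<open>j + 1\<close> in \<open>D\<close>.
\<close>

lift_definition H_op :: "L2 \<Rightarrow> ell2" is "\<lambda>x j. \<integral>t. x t * t ^ j \<partial>unit_interval"
proof (intro conjI moments_square_summable ext)
  fix x y :: "real \<Rightarrow> real" and j :: nat
  assume xy: "square_integrable unit_interval x \<and> square_integrable unit_interval y \<and>
    (AE t in unit_interval. x t = y t)"
  then show "square_integrable unit_interval x" by auto
  have [measurable]: "x \<in> borel_measurable unit_interval" "y \<in> borel_measurable unit_interval"
    "(\<lambda>t. t ^ j) \<in> borel_measurable unit_interval"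
    using xy square_integrable_power by (auto simp: square_integrable_def)
  have AE: "AE t in unit_interval. x t = y t" using xy by blast
  show "(\<integral>t. x t * t ^ j \<partial>unit_interval) = (\<integral>t. y t * t ^ j \<partial>unit_interval)"
    using AE by (intro integral_cong_AE borel_measurable_times) (auto elim: eventually_mono)
qed

lift_definition D_op :: "ell2 \<Rightarrow> ell2" is "\<lambda>y j. y j / real (j + 1)"
proof -
  fix y :: "nat \<Rightarrow> real" assume y: "summable (\<lambda>j. (y j)\<^sup>2)"
  have "(y j)\<^sup>2 / (real (j + 1))\<^sup>2 \<le> (y j)\<^sup>2 / 1" for j
    by (intro divide_left_mono one_le_power) auto
  then show "summable (\<lambda>j. (y j / real (j + 1))\<^sup>2)"
    by (intro summable_comparison_test'[OF y, of 0]) (simp add: power_divide)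
qed

lift_definition Cstar_op :: "L2 \<Rightarrow> L2" is "\<lambda>x t. LBINT s:{t<..<1}. x s / s"
proof (intro conjI Hardy_inequality)
  fix x y :: "real \<Rightarrow> real"
  assume xy: "square_integrable unit_interval x \<and> square_integrable unit_interval y \<and>
    (AE t in unit_interval. x t = y t)"
  then show "square_integrable unit_interval x" "square_integrable unit_interval y" by auto
  have [measurable]: "(\<lambda>s. indicator {0<..<1} s * x s) \<in> borel_measurable borel"
    "(\<lambda>s. indicator {0<..<1} s * y s) \<in> borel_measurable borel"
    using xy by (auto simp: square_integrable_def borel_measurable_restrict_space_iff)
  have AE: "AE s in lborel. s \<in> {0<..<1} \<longrightarrow> x s = y s"
    using xy by (simp add: AE_restrict_space_iff)
  have "(LBINT s:{t<..<1}. x s / s) = (LBINT s:{t<..<1}. y s / s)" if t: "0 < t" for t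
  proof -
    have eq: "(\<lambda>s. indicator {t<..<1} s *\<^sub>R (z s / s)) =
        (\<lambda>s. indicator {t<..<1} s * (indicator {0<..<1} s * z s) / s)" for z :: "real \<Rightarrow> real"
      using t by (auto simp: indicator_def)
    show ?thesis
      unfolding set_lebesgue_integral_def eq
    proof (rule integral_cong_AE)
      show "AE s in lborel. indicator {t<..<1} s * (indicator {0<..<1} s * x s) / s =
          indicator {t<..<1} s * (indicator {0<..<1} s * y s) / s"
        using AE by (rule eventually_mono) (auto simp: indicator_def)
    qed measurable
  qed
  then show "AE t in unit_interval. (LBINT s:{t<..<1}. x s / s) = (LBINT s:{t<..<1}. y s / s)"
    by (simp add: AE_restrict_space_iff)
qed

definition compact_operator :: "('a::real_normed_vector \<Rightarrow> 'b::real_normed_vector) \<Rightarrow> bool"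
  where "compact_operator T \<longleftrightarrow> linear T \<and> (\<forall>S. bounded S \<longrightarrow> compact (closure (T ` S)))"

text \<open>
  For \<open>s > 0\<close>, the multiplicity of \<open>s\<close> as a singular value of \<open>T\<close> is the dimension of the eigenspace
  of \<open>T* T\<close> for \<open>s\<^sup>2\<close>, finite when \<open>T\<close> is compact. Listing the singular values in decreasing order,
  each repeated according to its multiplicity, the \<open>i\<close>-th one (\<open>i \<ge> 1\<close>) is the greatest \<open>s > 0\<close> such
  that at least \<open>i\<close> entries of the list are \<open>\<ge> s\<close>; it is set to 0 if the list has fewer than \<open>i\<close>
  entries.
\<close>

definition singular_multiplicity :: "('a::real_inner \<Rightarrow> 'b::real_inner) \<Rightarrow> real \<Rightarrow> nat"
  where "singular_multiplicity T s = dim {x. adjoint T (T x) = s\<^sup>2 *\<^sub>R x}"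

definition singular_value :: "('a::real_inner \<Rightarrow> 'b::real_inner) \<Rightarrow> nat \<Rightarrow> real"
  where "singular_value T i = (GREATEST s. s = 0 \<or>
    s > 0 \<and> i \<le> (\<Sum>r | s \<le> r \<and> 0 < singular_multiplicity T r. singular_multiplicity T r))"

end

theory Submission
  imports Defs
begin

text \<open>
  The \<open>j\<close>-th coordinate of \<open>T x = D (H x)\<close> is the inner product of \<open>x\<close> with \<open>h j = t ^ j / (j + 1)\<close>,
  and the squares of the norms of the \<open>h j\<close> with \<open>j \<ge> n\<close> add up to at most \<open>2 / (n + 1)\<^sup>2\<close>: the rows of
  \<open>T\<close> from \<open>n\<close> on form a Hilbert-Schmidt operator of norm \<open>O(1/n)\<close>. If \<open>i\<close> orthonormal singular vectors
  have singular values \<open>\<ge> s\<close>, their normalised images are orthonormal, so the first \<open>n\<close> coordinates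
  carry at most \<open>n\<close> of their total squared norm \<open>i\<close>, and the remaining ones at most the squared
  Hilbert-Schmidt norm divided by \<open>s\<^sup>2\<close>. Hence \<open>(i - n) s\<^sup>2 \<le> 2 / (n + 1)\<^sup>2\<close>, and \<open>n = i div 2\<close> gives
  \<open>s \<le> 4 / i powr (3/2)\<close>. The singular values never run out because \<open>T\<close> is compact and the monomials
  span an infinite-dimensional space.
\<close>

section \<open>Orthonormal systems\<close>

text \<open>With \<open>y\<close> the projection of \<open>x\<close> onto the span of the
  \<open>f i\<close>, both \<open>inner x y\<close> and \<open>inner y y\<close> equal the left-hand
  sum \<open>S\<close>, so \<open>norm (x - y)\<close> squared is the difference of the two sides.
  An indexed family is used because the normalised images of singular vectors come indexed by those
  vectors.\<close>

lemma Bessel_inequality: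
  fixes f :: "'i \<Rightarrow> 'a::real_inner"
  assumes "finite I" "\<And>i. i \<in> I \<Longrightarrow> norm (f i) = 1"
    and orth: "\<And>i j. i \<in> I \<Longrightarrow> j \<in> I \<Longrightarrow> i \<noteq> j \<Longrightarrow> inner (f i) (f j) = 0"
  shows "(\<Sum>i\<in>I. (inner x (f i))\<^sup>2) \<le> (norm x)\<^sup>2"
proof -
  define S y where "S = (\<Sum>i\<in>I. (inner x (f i))\<^sup>2)" and "y = (\<Sum>i\<in>I. inner x (f i) *\<^sub>R f i)"
  have xy: "inner x y = S"
    by (simp add: S_def y_def inner_sum_right power2_eq_square)
  have "inner (f i) y = inner x (f i)" if "i \<in> I" for i
  proof -
    have "inner (f i) y = (\<Sum>j\<in>I. if j = i then inner x (f i) else 0)"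
      unfolding y_def inner_sum_right
      using assms that by (intro sum.cong) (auto simp: dot_square_norm orth)
    then show ?thesis using that \<open>finite I\<close> by simp
  qed
  then have "inner y y = S"
    by (subst (1) y_def) (simp add: inner_sum_left S_def power2_eq_square)
  then have "inner (x - y) (x - y) = (norm x)\<^sup>2 - S"
    using xy by (simp add: inner_diff inner_commute[of y x] power2_norm_eq_inner)
  then show ?thesis
    using inner_ge_zero[of "x - y"] by (simp add: S_def)
qed

definition orthonormal :: "'a::real_inner set \<Rightarrow> bool"
  where "orthonormal E \<longleftrightarrow> pairwise orthogonal E \<and> (\<forall>e\<in>E. norm e = 1)"

lemma orthonormal_inner:
  "orthonormal E \<Longrightarrow> e \<in> E \<Longrightarrow> f \<in> E \<Longrightarrow> inner e f = (if e = f then 1 else 0)"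
  by (auto simp: orthonormal_def pairwise_def orthogonal_def dot_square_norm)

text \<open>The witness is the finite Fourier sum. Its error is orthogonal to each basis vector,
  hence to the span, since the vectors orthogonal to a fixed one form a subspace.\<close>

lemma orthonormal_projection:
  fixes E :: "'a::real_inner set"
  assumes "finite E" "orthonormal E"
  obtains p where "p \<in> span E" "\<And>v. v \<in> span E \<Longrightarrow> inner (x - p) v = 0"
proof
  define p where "p = (\<Sum>e\<in>E. inner x e *\<^sub>R e)"
  show "p \<in> span E"
    unfolding p_def by (rule span_sum) (simp add: span_scale span_base)
  have orth: "inner (x - p) e = 0" if "e \<in> E" for e
  proof -
    have "inner p e = (\<Sum>f\<in>E. if f = e then inner x e else 0)"
      unfolding p_def inner_sum_left
      using that orthonormal_inner[OF assms(2) _ that] by (intro sum.cong) auto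
    then show ?thesis using assms(1) that by (simp add: inner_diff_left)
  qed
  have "subspace {v. inner (x - p) v = 0}"
    by (simp add: subspace_def inner_add_right)
  then have "span E \<subseteq> {v. inner (x - p) v = 0}"
    by (intro span_minimal) (auto simp: orth)
  then show "inner (x - p) v = 0" if "v \<in> span E" for v
    using that by blast
qed
lemma orthonormal_subset: "orthonormal E \<Longrightarrow> F \<subseteq> E \<Longrightarrow> orthonormal F"
  by (auto simp: orthonormal_def intro: pairwise_subset)

lemma orthonormal_independent: "orthonormal E \<Longrightarrow> independent E"
  by (rule pairwise_orthogonal_independent) (auto simp: orthonormal_def)

text \<open>Gram-Schmidt yields an orthogonal set that may contain 0 and is known only to be no
  larger than \<open>B\<close>. Dropping 0 and normalising keeps the span, and independence of
  \<open>B\<close> inside that span forces equal cardinality.\<close>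

lemma independent_imp_orthonormal:
  fixes B :: "'a::real_inner set"
  assumes "finite B" "independent B"
  obtains C where "finite C" "card C = card B" "span C = span B" "orthonormal C"
proof -
  obtain C where C: "finite C" "card C \<le> card B" "span C = span B" "pairwise orthogonal C"
    using basis_orthogonal[OF assms(1)] by blast
  define N where "N = (\<lambda>c::'a. (1 / norm c) *\<^sub>R c)"
  define D where "D = N ` (C - {0})"
  have orth: "orthonormal D"
    using C(4) by (auto simp: orthonormal_def D_def N_def pairwise_def orthogonal_def)
  have "span D = span (C - {0})"
  proof (rule subset_antisym; rule span_minimal)
    show "D \<subseteq> span (C - {0})"
      by (auto simp: D_def N_def intro!: span_mul intro: span_base)
    show "C - {0} \<subseteq> span D"
    proof
      fix c assume c: "c \<in> C - {0}"
      then have "N c \<in> D" by (simp add: D_def)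
      then have "norm c *\<^sub>R N c \<in> span D" by (intro span_mul span_base)
      then show "c \<in> span D" using c by (simp add: N_def)
    qed
  qed auto
  then have spanD: "span D = span B" using C(3) by simp
  have "card D \<le> card C"
    unfolding D_def using C(1) by (meson card_image_le card_mono finite_Diff Diff_subset le_trans)
  moreover have "card B \<le> card D"
    using C(1) assms spanD
    by (intro conjunct2[OF independent_span_bound]) (auto simp: D_def intro: span_base)
  ultimately show ?thesis
    using that[of D] C(1,2) orth spanD by (auto simp: D_def)
qed

text \<open>The ambient space may be infinite-dimensional, so finiteness of a basis has to come from
  \<open>K\<close>: an infinite independent set would contain \<open>Suc K\<close> independent
  vectors, and orthonormalising them would contradict the bound.\<close>

lemma subspace_orthonormal_basis:
  fixes V :: "'a::real_inner set"
  assumes "subspace V" and K: "\<And>E. finite E \<Longrightarrow> orthonormal E \<Longrightarrow> E \<subseteq> V \<Longrightarrow> card E \<le> K"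
  obtains C where "finite C" "orthonormal C" "C \<subseteq> V" "span C = V" "card C = dim V"
proof -
  obtain B where B: "B \<subseteq> V" "independent B" "V \<subseteq> span B"
    using maximal_independent_subset[of V] by blast
  have fin: "finite B"
  proof (rule ccontr)
    assume "infinite B"
    then obtain F where F: "F \<subseteq> B" "finite F" "card F = Suc K"
      using infinite_arbitrarily_large by blast
    obtain C where C: "finite C" "card C = card F" "span C = span F" "orthonormal C"
      using independent_imp_orthonormal[OF F(2)] independent_mono[OF B(2) F(1)] by blast
    have "C \<subseteq> V"
      using C(3) F(1) B(1) assms(1) span_superset[of C] span_minimal[of F V] by blast
    then show False using K[OF C(1,4)] C(2) F(3) by simp
  qed
  obtain C where C: "finite C" "card C = card B" "span C = span B" "orthonormal C"
    using independent_imp_orthonormal[OF fin B(2)] by blast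
  have sB: "span B = V" using B assms(1) by (simp add: span_minimal subset_antisym)
  show ?thesis
  proof (rule that[of C])
    show "C \<subseteq> V" using C(3) sB span_superset by blast
    show "card C = dim V" using B C(2) by (metis basis_card_eq_dim)
  qed (use C sB in auto)
qed

section \<open>Singular vectors of operators with an adjoint\<close>

text \<open>The constant \<open>adjoint\<close> is a choice and is meaningful only once some adjoint
  is exhibited. Hence the adjoint is a parameter here, identified with the chosen one by uniqueness
  in \<open>adjoint_eq\<close>.\<close>

locale adjoint_pair =
  fixes T :: "'a::real_inner \<Rightarrow> 'b::real_inner" and T' :: "'b \<Rightarrow> 'a"
  assumes bounded_linear: "bounded_linear T"
    and adjoint: "\<And>x y. inner (T x) y = inner x (T' y)"
begin

interpretation T: bounded_linear T by (rule bounded_linear)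

lemma adjoint_eq: "adjoint T = T'"
  by (rule adjoint_unique) (simp add: adjoint)

text \<open>Linearity is tested against all vectors on the left. The bound comes from
  \<open>inner (T' y) (T' y) = inner (T (T' y)) y\<close> and Cauchy-Schwarz, after cancelling one
  factor \<open>norm (T' y)\<close>.\<close>

lemma bounded_linear_adjoint: "bounded_linear T'"
proof -
  obtain K where "0 \<le> K" and K: "\<And>x. norm (T x) \<le> norm x * K" using T.nonneg_bounded by blast
  show ?thesis
  proof (rule bounded_linear_intro[of _ K])
    show "T' (y + z) = T' y + T' z" for y z
      by (rule vector_eq_ldot[THEN iffD1, rule_format]) (simp add: inner_add_right flip: adjoint)
    show "T' (c *\<^sub>R y) = c *\<^sub>R T' y" for c y
      by (rule vector_eq_ldot[THEN iffD1, rule_format]) (simp flip: adjoint)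
    show "norm (T' y) \<le> norm y * K" for y
    proof -
      have "norm (T' y) * norm (T' y) = inner (T (T' y)) y"
        by (simp add: adjoint dot_square_norm power2_eq_square)
      also have "\<dots> \<le> norm (T (T' y)) * norm y" by (rule norm_cauchy_schwarz)
      also have "\<dots> \<le> (norm (T' y) * K) * norm y" by (intro mult_right_mono K) simp
      finally have "norm (T' y) * norm (T' y) \<le> norm (T' y) * (norm y * K)" by (simp add: mult_ac)
      then show ?thesis
        using \<open>0 \<le> K\<close> by (cases "T' y = 0") auto
    qed
  qed
qed

interpretation T': bounded_linear T' by (rule bounded_linear_adjoint)

definition sing_space :: "real \<Rightarrow> 'a set"
  where "sing_space r = {x. T' (T x) = r\<^sup>2 *\<^sub>R x}"

lemma singular_multiplicity_eq: "singular_multiplicity T r = dim (sing_space r)"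
  by (simp add: singular_multiplicity_def sing_space_def adjoint_eq)

lemma subspace_sing_space: "subspace (sing_space r)"
  by (auto simp: subspace_def sing_space_def T.add T.scaleR T'.add T'.scaleR scaleR_add_right)

lemma inner_T_sing_space: "x \<in> sing_space r \<Longrightarrow> inner (T x) (T y) = r\<^sup>2 * inner x y"
  using adjoint[of y "T x"] by (simp add: sing_space_def inner_commute[of _ y] inner_commute[of _ "T y"])

text \<open>Eigenvectors of the symmetric map \<open>T' o T\<close> for different eigenvalues are
  orthogonal. Positivity of \<open>r\<close> and \<open>q\<close> turns \<open>r \<noteq> q\<close>
  into different squares.\<close>

lemma sing_space_orthogonal:
  assumes "x \<in> sing_space r" "y \<in> sing_space q" "0 < r" "0 < q" "r \<noteq> q"
  shows "inner x y = 0"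
proof -
  have "r\<^sup>2 * inner x y = q\<^sup>2 * inner x y"
    using inner_T_sing_space[OF assms(1), of y] inner_T_sing_space[OF assms(2), of x]
    by (simp add: inner_commute)
  moreover have "r\<^sup>2 \<noteq> q\<^sup>2" using assms by (auto dest: power2_eq_imp_eq)
  ultimately show ?thesis by simp
qed

text \<open>This stands in for an initial segment of the decreasing list of singular values. Once
  such systems are bounded in size, for \<open>s > 0\<close> the largest of them has exactly
  \<open>sing_count T s\<close> elements, by \<open>sing_count_system\<close> and
  \<open>card_sing_system_le\<close>.\<close>

definition sing_system :: "real \<Rightarrow> 'a set \<Rightarrow> bool"
  where "sing_system s E \<longleftrightarrow> finite E \<and> orthonormal E \<and> (\<forall>e\<in>E. \<exists>r\<ge>s. e \<in> sing_space r)"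

lemma sing_system_inner_T:
  assumes "sing_system s E" "e \<in> E" "f \<in> E" "e \<noteq> f"
  shows "inner (T e) (T f) = 0"
proof -
  obtain r where "e \<in> sing_space r" using assms unfolding sing_system_def by blast
  moreover have "inner e f = 0"
    using assms orthonormal_inner[of E e f] unfolding sing_system_def by simp
  ultimately show ?thesis by (simp add: inner_T_sing_space)
qed

lemma sing_system_norm_T:
  assumes "sing_system s E" "e \<in> E" "0 \<le> s"
  shows "s \<le> norm (T e)"
proof -
  obtain r where r: "r \<ge> s" "e \<in> sing_space r" using assms unfolding sing_system_def by blast
  have "inner e e = 1" using assms orthonormal_inner[of E e e] unfolding sing_system_def by simp
  then have "(norm (T e))\<^sup>2 = r\<^sup>2"
    using inner_T_sing_space[OF r(2), of e] by (simp add: power2_norm_eq_inner)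
  then have "norm (T e) = r"
    by (rule power2_eq_imp_eq) (use r(1) assms(3) in auto)
  then show ?thesis using r(1) by simp
qed

end

section \<open>Counting singular values with multiplicity\<close>

definition sing_count :: "('a::real_inner \<Rightarrow> 'b::real_inner) \<Rightarrow> real \<Rightarrow> nat"
  where "sing_count T s =
    (\<Sum>r | s \<le> r \<and> 0 < singular_multiplicity T r. singular_multiplicity T r)"

text \<open>The assumption isolates the finiteness that makes multiplicities and counts meaningful.
  For Hilbert-Schmidt operators it follows from an explicit estimate.\<close>

locale adjoint_pair_bounded_systems = adjoint_pair +
  assumes systems_bounded: "\<And>s. 0 < s \<Longrightarrow> \<exists>K. \<forall>E. sing_system s E \<longrightarrow> card E \<le> K"
begin

lemma sing_space_basis:
  assumes "0 < r"
  obtains C where "finite C" "orthonormal C" "C \<subseteq> sing_space r" "span C = sing_space r"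
    "card C = singular_multiplicity T r"
proof -
  obtain K where "\<And>E. sing_system r E \<Longrightarrow> card E \<le> K" using systems_bounded[OF assms] by blast
  then have "\<And>E. finite E \<Longrightarrow> orthonormal E \<Longrightarrow> E \<subseteq> sing_space r \<Longrightarrow> card E \<le> K"
    unfolding sing_system_def by blast
  then show ?thesis
    using that unfolding singular_multiplicity_eq
    by (rule subspace_orthonormal_basis[OF subspace_sing_space])
qed

text \<open>The system is the union of orthonormal bases of the eigenspaces for \<open>r\<close> in
  \<open>F\<close>. Different eigenspaces are orthogonal, so the union is orthonormal and disjoint:
  a common unit vector would be orthogonal to itself.\<close>

lemma ex_sing_system:
  assumes "finite F" "0 < s" "\<And>r. r \<in> F \<Longrightarrow> s \<le> r"
  obtains E where "sing_system s E" "card E = (\<Sum>r\<in>F. singular_multiplicity T r)"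
proof -
  have "\<exists>C. finite C \<and> orthonormal C \<and> C \<subseteq> sing_space r \<and> card C = singular_multiplicity T r"
    if "r \<in> F" for r
  proof -
    have "0 < r" using assms(2) assms(3)[OF that] by simp
    then show ?thesis by (rule sing_space_basis) blast
  qed
  then obtain C where C: "\<And>r. r \<in> F \<Longrightarrow> finite (C r)" "\<And>r. r \<in> F \<Longrightarrow> orthonormal (C r)"
    "\<And>r. r \<in> F \<Longrightarrow> C r \<subseteq> sing_space r" "\<And>r. r \<in> F \<Longrightarrow> card (C r) = singular_multiplicity T r"
    by metis
  have pos: "r > 0" if "r \<in> F" for r using assms(2) assms(3)[OF that] by simp
  have orth: "inner x y = 0" if "x \<in> C r" "y \<in> C q" "r \<in> F" "q \<in> F" "r \<noteq> q" for x y r q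
    using that C(3) pos by (meson sing_space_orthogonal subsetD)
  have "sing_system s (\<Union>r\<in>F. C r)"
    unfolding sing_system_def orthonormal_def
  proof (intro conjI ballI)
    show "finite (\<Union>r\<in>F. C r)" using assms(1) C(1) by simp
    show "pairwise orthogonal (\<Union>r\<in>F. C r)"
    proof (rule pairwiseI)
      fix x y assume "x \<in> (\<Union>r\<in>F. C r)" "y \<in> (\<Union>r\<in>F. C r)" "x \<noteq> y"
      then obtain r q where rq: "r \<in> F" "q \<in> F" "x \<in> C r" "y \<in> C q" by blast
      show "orthogonal x y"
      proof (cases "r = q")
        case True
        then show ?thesis
          using rq C(2)[of r] \<open>x \<noteq> y\<close> by (auto simp: orthonormal_def pairwise_def)
      qed (use orth rq in \<open>auto simp: orthogonal_def\<close>)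
    qed
    fix e assume "e \<in> (\<Union>r\<in>F. C r)"
    then obtain r where "r \<in> F" "e \<in> C r" by blast
    then show "norm e = 1" "\<exists>r\<ge>s. e \<in> sing_space r"
      using C(2)[of r] C(3)[of r] assms(3)[of r] unfolding orthonormal_def by blast+
  qed
  moreover have "card (\<Union>r\<in>F. C r) = (\<Sum>r\<in>F. card (C r))"
  proof (rule card_UN_disjoint[OF assms(1)])
    show "\<forall>r\<in>F. \<forall>q\<in>F. r \<noteq> q \<longrightarrow> C r \<inter> C q = {}"
    proof (intro ballI impI equals0I)
      fix r q x assume rq: "r \<in> F" "q \<in> F" "r \<noteq> q" and "x \<in> C r \<inter> C q"
      then have x: "x \<in> C r" "x \<in> C q" by auto
      then have "inner x x = 0" by (rule orth[OF _ _ rq])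
      moreover have "norm x = 1" using C(2)[OF rq(1)] x(1) unfolding orthonormal_def by blast
      ultimately show False by simp
    qed
  qed (use C(1) in blast)
  ultimately show ?thesis by (intro that) (simp_all add: C(4))
qed

text \<open>Each singular value contributes at least one vector to a system, so \<open>Suc K\<close>
  of them would exceed the bound \<open>K\<close>. Without this the sum in \<open>sing_count\<close>
  could run over an infinite set, where it is 0 by convention.\<close>

lemma finite_sing_values:
  assumes "0 < s"
  shows "finite {r. s \<le> r \<and> 0 < singular_multiplicity T r}"
proof (rule ccontr)
  let ?R = "{r. s \<le> r \<and> 0 < singular_multiplicity T r}"
  assume inf: "infinite ?R"
  obtain K where K: "\<And>E. sing_system s E \<Longrightarrow> card E \<le> K" using systems_bounded[OF assms] by blast
  obtain F where F: "F \<subseteq> ?R" "finite F" "card F = Suc K"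
    using infinite_arbitrarily_large[OF inf] by blast
  obtain E where E: "sing_system s E" "card E = (\<Sum>r\<in>F. singular_multiplicity T r)"
    using ex_sing_system[OF F(2) assms] F(1) by blast
  have "(\<Sum>r\<in>F. 1) \<le> (\<Sum>r\<in>F. singular_multiplicity T r)"
    using F(1) by (intro sum_mono) auto
  then show False using K[OF E(1)] E(2) F(3) by simp
qed

lemma sing_count_system:
  assumes "0 < s"
  obtains E where "sing_system s E" "card E = sing_count T s"
  unfolding sing_count_def
  using ex_sing_system[OF finite_sing_values[OF assms] assms] by blast

text \<open>Each vector of \<open>E\<close> lies in some eigenspace with \<open>r \<ge> s\<close>,
  and an orthonormal set inside one eigenspace has at most as many elements as its dimension.
  Summing over the finitely many \<open>r\<close> gives the count.\<close>

lemma card_sing_system_le: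
  assumes "0 < s" "sing_system s E"
  shows "card E \<le> sing_count T s"
proof -
  let ?R = "{r. s \<le> r \<and> 0 < singular_multiplicity T r}"
  have E: "finite E" "orthonormal E" using assms(2) by (auto simp: sing_system_def)
  have le: "card (E \<inter> sing_space r) \<le> singular_multiplicity T r" if r: "s \<le> r" for r
  proof -
    obtain C where C: "finite C" "span C = sing_space r" "card C = singular_multiplicity T r"
      by (rule sing_space_basis[of r]) (use \<open>0 < s\<close> r in auto)
    have "independent (E \<inter> sing_space r)"
      by (rule orthonormal_independent[OF orthonormal_subset[OF E(2)]]) simp
    then show ?thesis
      using independent_span_bound[OF C(1), of "E \<inter> sing_space r"] C(2,3) by auto
  qed
  have "E \<subseteq> (\<Union>r\<in>?R. E \<inter> sing_space r)"
  proof
    fix e assume e: "e \<in> E"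
    then obtain r where r: "r \<ge> s" "e \<in> sing_space r" using assms(2) by (auto simp: sing_system_def)
    then have "0 < card (E \<inter> sing_space r)" using e E(1) by (auto simp: card_gt_0_iff)
    then have "0 < singular_multiplicity T r" using le[OF r(1)] by simp
    then show "e \<in> (\<Union>r\<in>?R. E \<inter> sing_space r)" using e r by blast
  qed
  then have "card E \<le> card (\<Union>r\<in>?R. E \<inter> sing_space r)"
    using E(1) finite_sing_values[OF assms(1)] by (intro card_mono) auto
  also have "\<dots> \<le> (\<Sum>r\<in>?R. card (E \<inter> sing_space r))"
    by (rule card_UN_le[OF finite_sing_values[OF assms(1)]])
  also have "\<dots> \<le> sing_count T s"
    unfolding sing_count_def by (intro sum_mono le) auto
  finally show ?thesis .
qed

text \<open>\<open>GREATEST\<close> has its intended value only if a maximum exists. The count is a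
  step function that changes only at singular values, so the maximum may be sought in the finite set
  \<open>Q\<close> of singular values \<open>\<ge> s\<close> whose count reaches \<open>i\<close>;
  the given system shows that \<open>Q\<close> is nonempty.\<close>

lemma singular_value_witness:
  assumes "1 \<le> i" "0 < s" "sing_system s E" "i \<le> card E"
  shows "0 < singular_value T i \<and> i \<le> sing_count T (singular_value T i)"
proof -
  let ?R = "\<lambda>s. {r. s \<le> r \<and> 0 < singular_multiplicity T r}"
  define Q where "Q = {r \<in> ?R s. i \<le> sing_count T r}"
  have fin: "finite Q"
    unfolding Q_def by (rule finite_subset[OF _ finite_sing_values[OF assms(2)]]) auto
  have ex: "\<exists>q. t \<le> q \<and> 0 < singular_multiplicity T q \<and> i \<le> sing_count T q"
    if t: "0 < t" "i \<le> sing_count T t" for t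
  proof -
    \<comment> \<open>An empty set would make the count 0, contrary to
      \<open>1 \<le> i\<close>.\<close>
    have "?R t \<noteq> {}" using t \<open>1 \<le> i\<close> by (auto simp: sing_count_def intro: ccontr)
    \<comment> \<open>Raising \<open>t\<close> to the next singular value loses no term of the sum,
      so the count is unchanged.\<close>
    define q where "q = Min (?R t)"
    have q: "q \<in> ?R t"
      unfolding q_def using finite_sing_values[OF t(1)] \<open>?R t \<noteq> {}\<close> by (rule Min_in)
    have "?R q = ?R t"
      using q Min_le[OF finite_sing_values[OF t(1)]] by (auto simp: q_def)
    then have "sing_count T q = sing_count T t" by (simp add: sing_count_def)
    then show ?thesis using q t by auto
  qed
  have s: "i \<le> sing_count T s"
    using card_sing_system_le[OF assms(2,3)] assms(4) by simp
  then have "Q \<noteq> {}" using ex[OF assms(2)] by (auto simp: Q_def)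
  define m where "m = Max Q"
  have m: "m \<in> Q" unfolding m_def using fin \<open>Q \<noteq> {}\<close> by (rule Max_in)
  have "singular_value T i = m"
    unfolding singular_value_def sing_count_def[symmetric]
  proof (rule Greatest_equality)
    show "m = 0 \<or> 0 < m \<and> i \<le> sing_count T m" using m assms(2) by (auto simp: Q_def)
    fix t assume t: "t = 0 \<or> 0 < t \<and> i \<le> sing_count T t"
    show "t \<le> m"
    proof (cases "t < s")
      case True
      then show ?thesis using m by (auto simp: Q_def)
    next
      case False
      then have "0 < t" "i \<le> sing_count T t" using t assms(2) by auto
      then obtain q where q: "t \<le> q" "0 < singular_multiplicity T q" "i \<le> sing_count T q"
        using ex by blast
      then have "q \<in> Q" using False by (simp add: Q_def)
      then have "q \<le> m" unfolding m_def using fin by (intro Max_ge)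
      then show ?thesis using q by simp
    qed
  qed
  then show ?thesis using m assms(2) by (auto simp: Q_def)
qed

end

section \<open>Existence of singular vectors for compact operators\<close>

context adjoint_pair
begin

interpretation T: bounded_linear T by (rule bounded_linear)
interpretation T': bounded_linear T' by (rule bounded_linear_adjoint)

text \<open>
  On the orthogonal complement \<open>M\<close> of \<open>E\<close>, which \<open>T'T\<close> leaves invariant, the norm of \<open>T\<close> is attained
  at a singular vector: a maximising sequence of unit vectors \<open>X n\<close> satisfies
  \<open>T'T X n - l\<^sup>2 X n \<rightarrow> 0\<close>, and compactness makes a subsequence converge.
\<close>

lemma ex_sing_vector:
  assumes cpt: "compact_operator T" and E: "\<And>e. e \<in> E \<Longrightarrow> \<exists>r. e \<in> sing_space r"
    and x0: "\<And>e. e \<in> E \<Longrightarrow> inner x0 e = 0" "T x0 \<noteq> 0"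
  obtains y r where "norm y = 1" "0 < r" "y \<in> sing_space r" "\<And>e. e \<in> E \<Longrightarrow> inner y e = 0"
proof -
  define M where "M = {x. \<forall>e\<in>E. inner x e = 0}"
  have M_scale: "c *\<^sub>R x \<in> M" if "x \<in> M" for c x using that by (simp add: M_def)
  have M_inv: "T' (T x) \<in> M" if "x \<in> M" for x
  proof -
    have "inner (T' (T x)) e = 0" if e: "e \<in> E" for e
    proof -
      obtain r where "e \<in> sing_space r" using E[OF e] by blast
      then have "inner (T e) (T x) = r\<^sup>2 * inner e x" by (rule inner_T_sing_space)
      also have "inner e x = 0" using \<open>x \<in> M\<close> e by (simp add: M_def inner_commute)
      finally show ?thesis by (simp add: adjoint inner_commute[of e])
    qed
    then show ?thesis by (simp add: M_def)
  qed
  define S where "S = (\<lambda>x. norm (T x)) ` {x \<in> M. norm x = 1}"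
  define l where "l = Sup S"
  obtain K where K: "\<And>x. norm (T x) \<le> norm x * K" using T.bounded by blast
  have bdd: "bdd_above S"
  proof (rule bdd_aboveI[of _ K])
    fix v assume "v \<in> S"
    then obtain x where "norm x = 1" "v = norm (T x)" by (auto simp: S_def)
    then show "v \<le> K" using K[of x] by simp
  qed
  have unit: "norm (T x) \<le> l" if "x \<in> M" "norm x = 1" for x
    unfolding l_def using bdd that by (intro cSup_upper) (auto simp: S_def)
  have scaled: "norm (T x) \<le> l * norm x" if "x \<in> M" for x
  proof (cases "x = 0")
    case True
    then show ?thesis by simp
  next
    case False
    then have "norm (T ((1 / norm x) *\<^sub>R x)) \<le> l" using that by (intro unit M_scale) auto
    then show ?thesis using False by (simp add: T.scaleR field_simps)
  qed
  have "x0 \<in> M" using x0(1) by (simp add: M_def)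
  have x0': "x0 \<noteq> 0" using x0(2) T.zero by auto
  \<comment> \<open>The vector \<open>x0\<close> keeps the supremum away from 0, which permits
    division by the square of \<open>l\<close> below.\<close>
  have "0 < l * norm x0" using scaled[OF \<open>x0 \<in> M\<close>] x0(2) zero_less_norm_iff[of "T x0"] by linarith
  then have l: "0 < l" using x0' by (simp add: zero_less_mult_iff)
  have "S \<noteq> {}"
    using M_scale[OF \<open>x0 \<in> M\<close>, of "1 / norm x0"] x0' by (auto simp: S_def intro!: exI[of _ "(1 / norm x0) *\<^sub>R x0"])
  have "\<exists>x\<in>M. norm x = 1 \<and> l - 1 / real (Suc n) < norm (T x)" for n
  proof -
    have "l - 1 / real (Suc n) < Sup S" by (simp add: l_def)
    then obtain v where "v \<in> S" "l - 1 / real (Suc n) < v" using less_cSupD[OF \<open>S \<noteq> {}\<close>] by blast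
    then show ?thesis unfolding S_def by blast
  qed
  then obtain X where X: "\<And>n. X n \<in> M" "\<And>n. norm (X n) = 1"
    "\<And>n. l - 1 / real (Suc n) < norm (T (X n))" by metis
  have TX: "(\<lambda>n. norm (T (X n))) \<longlonglongrightarrow> l"
  proof (rule tendsto_sandwich)
    show "(\<lambda>n. l - 1 / real (Suc n)) \<longlonglongrightarrow> l"
      using tendsto_diff[OF tendsto_const LIMSEQ_inverse_real_of_nat, of l] by (simp add: inverse_eq_divide)
    show "\<forall>\<^sub>F n in sequentially. l - 1 / real (Suc n) \<le> norm (T (X n))"
      by (intro always_eventually allI less_imp_le X)
    show "\<forall>\<^sub>F n in sequentially. norm (T (X n)) \<le> l"
      by (intro always_eventually allI unit X)
  qed simp
  \<comment> \<open>Since \<open>T' (T x)\<close> stays in \<open>M\<close>, the bound by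
    \<open>l\<close> applies to it as well. Having \<open>l\<close> here, rather than the norm of
    \<open>T\<close> on the whole space, is what makes the bound in \<open>D_le\<close> tend to
    0.\<close>
  have A_le: "norm (T' (T x)) \<le> l * norm (T x)" if "x \<in> M" for x
  proof -
    have "norm (T' (T x)) * norm (T' (T x)) = inner (T (T' (T x))) (T x)"
      by (simp add: adjoint flip: power2_norm_eq_inner power2_eq_square)
    also have "\<dots> \<le> norm (T (T' (T x))) * norm (T x)" by (rule norm_cauchy_schwarz)
    also have "\<dots> \<le> (l * norm (T' (T x))) * norm (T x)"
      by (intro mult_right_mono scaled M_inv that) simp
    finally have "norm (T' (T x)) * norm (T' (T x)) \<le> norm (T' (T x)) * (l * norm (T x))"
      by (simp add: mult_ac)
    then show ?thesis using l by (cases "T' (T x) = 0") auto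
  qed
  define D where "D = (\<lambda>n. T' (T (X n)) - l\<^sup>2 *\<^sub>R X n)"
  have D_le: "(norm (D n))\<^sup>2 \<le> l\<^sup>2 * (l\<^sup>2 - (norm (T (X n)))\<^sup>2)" for n
  proof -
    have "inner (T' (T (X n))) (X n) = (norm (T (X n)))\<^sup>2"
      using adjoint[of "X n" "T (X n)"] by (simp add: power2_norm_eq_inner inner_commute[of _ "X n"])
    then have "(norm (D n))\<^sup>2 = (norm (T' (T (X n))))\<^sup>2 - 2 * (l\<^sup>2 * (norm (T (X n)))\<^sup>2) + (l\<^sup>2)\<^sup>2"
      using dot_norm_neg[of "T' (T (X n))" "l\<^sup>2 *\<^sub>R X n"] X(2)[of n] by (simp add: D_def)
    moreover have "(norm (T' (T (X n))))\<^sup>2 \<le> l\<^sup>2 * (norm (T (X n)))\<^sup>2"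
      using power_mono[OF A_le[OF X(1)[of n]], of 2] by (simp add: power_mult_distrib)
    moreover have "l\<^sup>2 * (l\<^sup>2 - (norm (T (X n)))\<^sup>2) = (l\<^sup>2)\<^sup>2 - l\<^sup>2 * (norm (T (X n)))\<^sup>2"
      by (simp add: right_diff_distrib power2_eq_square)
    ultimately show ?thesis by linarith
  qed
  have "(\<lambda>n. (norm (D n))\<^sup>2) \<longlonglongrightarrow> 0"
  proof (rule tendsto_sandwich[OF _ _ tendsto_const])
    have "(\<lambda>n. l\<^sup>2 * (l\<^sup>2 - (norm (T (X n)))\<^sup>2)) \<longlonglongrightarrow> l\<^sup>2 * (l\<^sup>2 - l\<^sup>2)"
      by (intro tendsto_intros TX)
    then show "(\<lambda>n. l\<^sup>2 * (l\<^sup>2 - (norm (T (X n)))\<^sup>2)) \<longlonglongrightarrow> 0" by simp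
  qed (use D_le in simp_all)
  then have "(\<lambda>n. sqrt ((norm (D n))\<^sup>2)) \<longlonglongrightarrow> sqrt 0" by (rule tendsto_real_sqrt)
  then have D: "D \<longlonglongrightarrow> 0" by (simp add: tendsto_norm_zero_iff)
  have "bounded (range X)" using X(2) by (auto intro!: boundedI[of _ 1])
  then have "compact (closure (T ` range X))" using cpt by (simp add: compact_operator_def)
  moreover have "\<forall>n. T (X n) \<in> closure (T ` range X)" by (intro allI subsetD[OF closure_subset]) simp
  ultimately obtain z r where r: "strict_mono r" and "((\<lambda>n. T (X n)) \<circ> r) \<longlonglongrightarrow> z"
    using compact_imp_seq_compact by (metis (no_types, lifting) seq_compactE)
  then have z: "(\<lambda>n. T (X (r n))) \<longlonglongrightarrow> z" by (simp add: comp_def)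
  define y where "y = (1 / l\<^sup>2) *\<^sub>R T' z"
  have Dr: "(\<lambda>n. D (r n)) \<longlonglongrightarrow> 0" using LIMSEQ_subseq_LIMSEQ[OF D r] by (simp add: comp_def)
  \<comment> \<open>Compactness makes only the images \<open>T (X (r n))\<close> converge. Solving
    the definition of \<open>D\<close> for \<open>X\<close> carries convergence over to the vectors
    themselves.\<close>
  have "(\<lambda>n. (1 / l\<^sup>2) *\<^sub>R (T' (T (X (r n))) - D (r n))) \<longlonglongrightarrow> (1 / l\<^sup>2) *\<^sub>R (T' z - 0)"
    by (intro tendsto_intros T'.tendsto z Dr)
  moreover have "(1 / l\<^sup>2) *\<^sub>R (T' (T (X (r n))) - D (r n)) = X (r n)" for n
    using l by (simp add: D_def)
  ultimately have y: "(\<lambda>n. X (r n)) \<longlonglongrightarrow> y" by (simp add: y_def)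
  have "(\<lambda>n. D (r n)) \<longlonglongrightarrow> T' (T y) - l\<^sup>2 *\<^sub>R y"
    unfolding D_def by (intro tendsto_intros T'.tendsto T.tendsto y)
  then have "T' (T y) - l\<^sup>2 *\<^sub>R y = 0" using Dr by (rule LIMSEQ_unique)
  then have "y \<in> sing_space l" by (simp add: sing_space_def)
  moreover have "norm y = 1"
    using tendsto_norm[OF y] X(2) by (simp add: LIMSEQ_const_iff)
  moreover have "inner y e = 0" if "e \<in> E" for e
  proof -
    have "(\<lambda>n. inner (X (r n)) e) \<longlonglongrightarrow> inner y e" by (intro tendsto_intros y)
    moreover have "inner (X (r n)) e = 0" for n using X(1)[of "r n"] that by (simp add: M_def)
    ultimately show ?thesis by (simp add: LIMSEQ_const_iff)
  qed
  ultimately show ?thesis using l by (intro that[of y l])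
qed

text \<open>Induction on \<open>n\<close>: a vector orthogonal to the present system and not killed
  by \<open>T\<close> lets \<open>ex_sing_vector\<close> supply one more singular vector. The
  threshold becomes \<open>min s r\<close>, so the order in which singular values appear need not be
  tracked.\<close>

lemma ex_large_sing_system:
  assumes cpt: "compact_operator T"
    and inf: "\<And>E. finite E \<Longrightarrow> orthonormal E \<Longrightarrow> \<exists>x. (\<forall>e\<in>E. inner x e = 0) \<and> T x \<noteq> 0"
  shows "\<exists>s>0. \<exists>E. sing_system s E \<and> card E = n"
proof (induction n)
  case 0
  have "sing_system 1 {}" by (simp add: sing_system_def orthonormal_def pairwise_def)
  then show ?case by (meson card.empty zero_less_one)
next
  case (Suc n)
  then obtain s E where s: "0 < s" and E: "sing_system s E" "card E = n" by blast
  then have fin: "finite E" "orthonormal E" and sv: "\<And>e. e \<in> E \<Longrightarrow> \<exists>r\<ge>s. e \<in> sing_space r"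
    unfolding sing_system_def by blast+
  obtain x0 where x0: "\<And>e. e \<in> E \<Longrightarrow> inner x0 e = 0" "T x0 \<noteq> 0" using inf[OF fin] by blast
  obtain y r where y: "norm y = 1" "0 < r" "y \<in> sing_space r" "\<And>e. e \<in> E \<Longrightarrow> inner y e = 0"
    using ex_sing_vector[OF cpt _ x0, of E] sv by blast
  have "y \<notin> E" using y(1) y(4)[of y] by auto
  have "sing_system (min s r) (insert y E)"
    unfolding sing_system_def
  proof (intro conjI ballI)
    show "orthonormal (insert y E)"
      using fin(2) y(1,4) by (auto simp: orthonormal_def pairwise_insert orthogonal_def inner_commute)
    fix e assume "e \<in> insert y E"
    then show "\<exists>q\<ge>min s r. e \<in> sing_space q"
      using sv y(3) by (metis insert_iff min.cobounded2 min.coboundedI1)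
  qed (use fin in simp)
  moreover have "card (insert y E) = Suc n" using \<open>y \<notin> E\<close> fin(1) E(2) by simp
  moreover have "0 < min s r" using s y(2) by simp
  ultimately show ?case by blast
qed

end

section \<open>Hilbert-Schmidt operators into \<open>ell2\<close>\<close>

text \<open>A closed subset of a complete space is complete, so total boundedness remains. A finite
  \<open>e/3\<close>-net of \<open>K\<close> is an \<open>e\<close>-net of the closure: one third
  goes from the closure to \<open>A\<close>, one from \<open>A\<close> to \<open>K\<close>, one from
  \<open>K\<close> to the net.\<close>

lemma compact_closure_approx:
  fixes A :: "'a::complete_space set"
  assumes approx: "\<And>e. 0 < e \<Longrightarrow> \<exists>K. compact K \<and> (\<forall>x\<in>A. \<exists>y\<in>K. dist x y < e)"
  shows "compact (closure A)"
  unfolding compact_eq_totally_bounded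
proof (intro conjI allI impI)
  show "complete (closure A)" by (simp add: complete_eq_closed)
  fix e :: real assume "0 < e"
  then have e: "0 < e/3" by simp
  obtain K where K: "compact K" "\<And>x. x \<in> A \<Longrightarrow> \<exists>y\<in>K. dist x y < e/3"
    using approx[OF e] by blast
  obtain F where F: "finite F" "K \<subseteq> (\<Union>x\<in>F. ball x (e/3))"
    using K(1) e unfolding compact_eq_totally_bounded by blast
  have "closure A \<subseteq> (\<Union>x\<in>F. ball x e)"
  proof
    fix x assume "x \<in> closure A"
    then obtain a where a: "a \<in> A" "dist a x < e/3" using e closure_approachable by blast
    obtain y where y: "y \<in> K" "dist a y < e/3" using K(2)[OF a(1)] by blast
    obtain z where z: "z \<in> F" "dist z y < e/3" using F(2) y(1) by auto
    have "dist z x \<le> dist z y + dist a y + dist a x"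
      using dist_triangle[of z x y] dist_triangle[of y x a] by (simp add: dist_commute)
    then have "dist z x < e" using a(2) y(2) z(2) by simp
    then show "x \<in> (\<Union>x\<in>F. ball x e)" using z(1) by auto
  qed
  then show "\<exists>F. finite F \<and> closure A \<subseteq> (\<Union>x\<in>F. ball x e)" using F(1) by blast
qed

section \<open>Coordinates, truncations and compact boxes in \<open>ell2\<close>\<close>

lemma ell2_inner: "inner x y = (\<Sum>j. ell2_nth x j * ell2_nth y j)"
  by (simp add: inner_ell2.rep_eq)

lemma ell2_summable: "summable (\<lambda>j. (ell2_nth x j)\<^sup>2)"
  using ell2_nth by auto

lemma ell2_norm_power2: "(norm x)\<^sup>2 = (\<Sum>j. (ell2_nth x j)\<^sup>2)"
  unfolding power2_norm_eq_inner by (simp add: ell2_inner power2_eq_square)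

lemma ell2_norm_sums: "(\<lambda>j. (ell2_nth x j)\<^sup>2) sums (norm x)\<^sup>2"
  by (simp add: ell2_norm_power2 ell2_summable summable_sums)

lemma ell2_eqI: "(\<And>j. ell2_nth x j = ell2_nth y j) \<Longrightarrow> x = y"
  by (metis ell2_nth_inject ext)

lift_definition ell2_unit :: "nat \<Rightarrow> ell2" is "\<lambda>i j. if j = i then 1 else 0"
proof -
  fix i :: nat
  have "(\<lambda>j. (if j = i then 1 else 0 :: real)\<^sup>2) = (\<lambda>j. if j = i then 1 else 0)" by auto
  then show "summable (\<lambda>j. (if j = i then 1 else 0 :: real)\<^sup>2)" by simp
qed

lemma inner_ell2_unit: "inner x (ell2_unit i) = ell2_nth x i"
proof -
  have "(\<lambda>j. ell2_nth x j * ell2_nth (ell2_unit i) j) = (\<lambda>j. if j = i then ell2_nth x j else 0)"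
    by (auto simp: ell2_unit.rep_eq)
  then show ?thesis using sums_single[of i "ell2_nth x"] by (simp add: ell2_inner sums_iff)
qed

lemma norm_ell2_unit: "norm (ell2_unit i) = 1"
  by (simp add: norm_eq_1 inner_ell2_unit ell2_unit.rep_eq)

lemma ell2_nth_sum: "ell2_nth (sum f I) j = (\<Sum>i\<in>I. ell2_nth (f i) j)"
  by (induction I rule: infinite_finite_induct) (simp_all add: zero_ell2.rep_eq plus_ell2.rep_eq)

definition ell2_trunc :: "nat \<Rightarrow> ell2 \<Rightarrow> ell2"
  where "ell2_trunc n y = (\<Sum>j<n. ell2_nth y j *\<^sub>R ell2_unit j)"

lemma ell2_nth_trunc: "ell2_nth (ell2_trunc n y) j = (if j < n then ell2_nth y j else 0)"
  by (simp add: ell2_trunc_def ell2_nth_sum scaleR_ell2.rep_eq ell2_unit.rep_eq if_distrib cong: if_cong)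

lemma ell2_trunc_error: "(norm (y - ell2_trunc n y))\<^sup>2 = (\<Sum>j. (ell2_nth y (j + n))\<^sup>2)"
proof -
  have "ell2_nth (y - ell2_trunc n y) j = (if j < n then 0 else ell2_nth y j)" for j
    by (simp add: minus_ell2.rep_eq ell2_nth_trunc)
  then show ?thesis
    unfolding ell2_norm_power2
    using suminf_split_initial_segment[OF ell2_summable[of "y - ell2_trunc n y"], of n] by simp
qed

text \<open>Adding a coordinate presents the box as the continuous image of the product of the
  smaller box and a compact interval.\<close>

lemma compact_ell2_box: "compact {\<Sum>j<n. a j *\<^sub>R ell2_unit j |a. \<forall>j<n. \<bar>a j\<bar> \<le> R}"
proof (induction n)
  case 0
  then show ?case by simp
next
  case (Suc n)
  let ?K = "\<lambda>n. {\<Sum>j<n. a j *\<^sub>R ell2_unit j |a. \<forall>j<n. \<bar>a j\<bar> \<le> R}"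
  have "compact ((\<lambda>p. fst p + snd p *\<^sub>R ell2_unit n) ` (?K n \<times> {-R..R}))"
    by (intro compact_continuous_image compact_Times Suc compact_Icc continuous_intros)
  moreover have "?K (Suc n) = (\<lambda>p. fst p + snd p *\<^sub>R ell2_unit n) ` (?K n \<times> {-R..R})"
  proof (intro equalityI subsetI)
    fix y assume "y \<in> ?K (Suc n)"
    then obtain a where a: "y = (\<Sum>j<Suc n. a j *\<^sub>R ell2_unit j)" "\<forall>j<Suc n. \<bar>a j\<bar> \<le> R" by blast
    then have "(\<Sum>j<n. a j *\<^sub>R ell2_unit j, a n) \<in> ?K n \<times> {-R..R}"
      by (auto simp: abs_le_iff less_Suc_eq)
    then show "y \<in> (\<lambda>p. fst p + snd p *\<^sub>R ell2_unit n) ` (?K n \<times> {-R..R})"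
      using a(1) by (intro image_eqI[where x = "(\<Sum>j<n. a j *\<^sub>R ell2_unit j, a n)"]) auto
  next
    fix y assume "y \<in> (\<lambda>p. fst p + snd p *\<^sub>R ell2_unit n) ` (?K n \<times> {-R..R})"
    then obtain q where q: "q \<in> ?K n \<times> {-R..R}" "y = fst q + snd q *\<^sub>R ell2_unit n" by (rule imageE)
    define b where "b = snd q"
    from q(1) obtain a where "fst q = (\<Sum>j<n. a j *\<^sub>R ell2_unit j)" "\<forall>j<n. \<bar>a j\<bar> \<le> R"
      by (auto simp: mem_Times_iff)
    with q have a: "\<forall>j<n. \<bar>a j\<bar> \<le> R" "\<bar>b\<bar> \<le> R"
      "y = (\<Sum>j<n. a j *\<^sub>R ell2_unit j) + b *\<^sub>R ell2_unit n"
      by (auto simp: b_def mem_Times_iff abs_le_iff)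
    have "y = (\<Sum>j<Suc n. (a(n := b)) j *\<^sub>R ell2_unit j)" using a(3) by simp
    moreover have "\<forall>j<Suc n. \<bar>(a(n := b)) j\<bar> \<le> R" using a(1,2) by (auto simp: less_Suc_eq)
    ultimately show "y \<in> ?K (Suc n)" by blast
  qed
  ultimately show ?case by simp
qed

text \<open>
  The operators into \<open>ell2\<close> of this form are exactly the Hilbert-Schmidt ones: \<open>h j\<close> is the image of
  the \<open>j\<close>-th unit vector under the adjoint.
\<close>

locale hilbert_schmidt =
  fixes T :: "'a::{real_inner, banach} \<Rightarrow> ell2" and h :: "nat \<Rightarrow> 'a"
  assumes nth: "\<And>x j. ell2_nth (T x) j = inner x (h j)"
    and summable_h: "summable (\<lambda>j. (norm (h j))\<^sup>2)"
begin

text \<open>Cauchy-Schwarz in each coordinate. The case \<open>n = 0\<close> bounds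
  \<open>T\<close>; large \<open>n\<close> makes truncation uniformly accurate on bounded
  sets.\<close>

lemma tail_le: "(\<Sum>j. (ell2_nth (T x) (j + n))\<^sup>2) \<le> (norm x)\<^sup>2 * (\<Sum>j. (norm (h (j + n)))\<^sup>2)"
proof -
  have sm: "summable (\<lambda>j. (norm (h (j + n)))\<^sup>2)" by (rule summable_ignore_initial_segment[OF summable_h])
  have "(ell2_nth (T x) (j + n))\<^sup>2 \<le> (norm x)\<^sup>2 * (norm (h (j + n)))\<^sup>2" for j
    using Cauchy_Schwarz_ineq[of x "h (j + n)"] by (simp add: nth power2_norm_eq_inner)
  moreover have "summable (\<lambda>j. (ell2_nth (T x) (j + n))\<^sup>2)"
    by (rule summable_ignore_initial_segment[OF ell2_summable])
  ultimately have "(\<Sum>j. (ell2_nth (T x) (j + n))\<^sup>2) \<le> (\<Sum>j. (norm x)\<^sup>2 * (norm (h (j + n)))\<^sup>2)"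
    using sm by (intro suminf_le summable_mult)
  then show ?thesis using suminf_mult[OF sm] by simp
qed

lemma bounded_linear_T: "bounded_linear T"
proof (rule bounded_linear_intro)
  show "T (x + y) = T x + T y" for x y
    by (rule ell2_eqI) (simp add: nth plus_ell2.rep_eq inner_add_left)
  show "T (c *\<^sub>R x) = c *\<^sub>R T x" for c x
    by (rule ell2_eqI) (simp add: nth scaleR_ell2.rep_eq)
  show "norm (T x) \<le> norm x * sqrt (\<Sum>j. (norm (h j))\<^sup>2)" for x
  proof (rule power2_le_imp_le)
    have "0 \<le> (\<Sum>j. (norm (h j))\<^sup>2)" by (rule suminf_nonneg[OF summable_h]) simp
    then show "(norm (T x))\<^sup>2 \<le> (norm x * sqrt (\<Sum>j. (norm (h j))\<^sup>2))\<^sup>2"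
        "0 \<le> norm x * sqrt (\<Sum>j. (norm (h j))\<^sup>2)"
      using tail_le[of x 0] by (simp_all add: ell2_norm_power2[of "T x"] power_mult_distrib)
  qed
qed

text \<open>The series converges absolutely, because the coordinates of \<open>y\<close> and the
  norms of the \<open>h j\<close> are both square-summable; completeness of \<open>'a\<close> then
  gives a limit.\<close>

definition T_adj :: "ell2 \<Rightarrow> 'a"
  where "T_adj y = (\<Sum>j. ell2_nth y j *\<^sub>R h j)"

sublocale adjoint_pair T T_adj
proof (rule adjoint_pair.intro)
  show "bounded_linear T" by (rule bounded_linear_T)
  fix x y
  have "summable (\<lambda>j. \<bar>ell2_nth y j\<bar> * norm (h j))"
    using ell2_summable[of y] summable_h by (intro ell2_summable_mult) simp_all
  then have "summable (\<lambda>j. norm (ell2_nth y j *\<^sub>R h j))" by simp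
  then have sm: "summable (\<lambda>j. ell2_nth y j *\<^sub>R h j)" by (rule summable_norm_cancel)
  have "inner x (T_adj y) = (\<Sum>j. inner x (ell2_nth y j *\<^sub>R h j))"
    unfolding T_adj_def by (rule bounded_linear.suminf[OF bounded_linear_inner_right sm])
  also have "\<dots> = inner (T x) y" by (simp add: ell2_inner nth mult.commute)
  finally show "inner (T x) y = inner x (T_adj y)" by simp
qed

text \<open>On a bounded set the truncations of \<open>T x\<close> are uniformly close to
  \<open>T x\<close> by \<open>tail_le\<close>, and they lie in a compact box because the
  coordinates of \<open>T x\<close> are bounded by \<open>B * K\<close>.\<close>

lemma compact: "compact_operator T"
  unfolding compact_operator_def
proof (intro conjI allI impI)
  show "linear T" using bounded_linear_T by (simp add: bounded_linear.linear)
  fix S :: "'a set" assume "bounded S"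
  then obtain B where B: "0 < B" "\<And>x. x \<in> S \<Longrightarrow> norm x \<le> B"
    unfolding bounded_pos by blast
  obtain K where K: "0 \<le> K" "\<And>x. norm (T x) \<le> norm x * K"
    using bounded_linear.nonneg_bounded[OF bounded_linear_T] by blast
  show "compact (closure (T ` S))"
  proof (rule compact_closure_approx)
    fix e :: real assume "0 < e"
    have "(\<lambda>n. \<Sum>j. (norm (h (j + n)))\<^sup>2) \<longlonglongrightarrow> 0" by (rule suminf_exist_split2[OF summable_h])
    moreover have "0 < e\<^sup>2 / B\<^sup>2" using \<open>0 < e\<close> B(1) by simp
    ultimately have "\<forall>\<^sub>F n in sequentially. (\<Sum>j. (norm (h (j + n)))\<^sup>2) < e\<^sup>2 / B\<^sup>2"
      by (simp add: order_tendstoD)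
    then obtain n where n: "(\<Sum>j. (norm (h (j + n)))\<^sup>2) < e\<^sup>2 / B\<^sup>2"
      by (auto simp: eventually_sequentially)
    have "dist (T x) (ell2_trunc n (T x)) < e"
      "ell2_trunc n (T x) \<in> {\<Sum>j<n. a j *\<^sub>R ell2_unit j |a. \<forall>j<n. \<bar>a j\<bar> \<le> B * K}" if x: "x \<in> S" for x
    proof -
      have "(norm (T x - ell2_trunc n (T x)))\<^sup>2 \<le> (norm x)\<^sup>2 * (\<Sum>j. (norm (h (j + n)))\<^sup>2)"
        unfolding ell2_trunc_error by (rule tail_le)
      also have "\<dots> \<le> B\<^sup>2 * (\<Sum>j. (norm (h (j + n)))\<^sup>2)"
        using B(2)[OF x] summable_ignore_initial_segment[OF summable_h, of n]
        by (intro mult_right_mono power_mono suminf_nonneg) auto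
      also have "\<dots> < e\<^sup>2" using n B(1) by (simp add: pos_less_divide_eq mult.commute)
      finally show "dist (T x) (ell2_trunc n (T x)) < e"
        unfolding dist_norm by (rule power_less_imp_less_base) (use \<open>0 < e\<close> in simp)
      have "\<bar>ell2_nth (T x) j\<bar> \<le> B * K" for j
      proof -
        have "\<bar>ell2_nth (T x) j\<bar> \<le> norm (T x)"
          using Cauchy_Schwarz_ineq2[of "T x" "ell2_unit j"] by (simp add: inner_ell2_unit norm_ell2_unit)
        also have "\<dots> \<le> norm x * K" by (rule K)
        also have "\<dots> \<le> B * K" using B(2)[OF x] K(1) by (intro mult_right_mono)
        finally show ?thesis .
      qed
      then show "ell2_trunc n (T x) \<in> {\<Sum>j<n. a j *\<^sub>R ell2_unit j |a. \<forall>j<n. \<bar>a j\<bar> \<le> B * K}"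
        unfolding ell2_trunc_def by (intro CollectI exI[of _ "ell2_nth (T x)"]) simp
    qed
    then have "\<forall>y\<in>T ` S. \<exists>z\<in>{\<Sum>j<n. a j *\<^sub>R ell2_unit j |a. \<forall>j<n. \<bar>a j\<bar> \<le> B * K}. dist y z < e"
      by (intro ballI, elim imageE, hypsubst) (rule bexI)
    with compact_ell2_box[of n "B * K"] show "\<exists>K. compact K \<and> (\<forall>y\<in>T ` S. \<exists>z\<in>K. dist y z < e)"
      by (intro exI conjI)
  qed
qed

text \<open>
  With \<open>f e = T e / norm (T e)\<close>, Bessel's inequality for the orthonormal family \<open>f\<close> bounds each of the
  first \<open>n\<close> coordinates of all \<open>f e\<close> together by 1, and Bessel's inequality for \<open>E\<close> bounds
  the \<open>j\<close>-th coordinates together by \<open>(norm (h j) / s)\<^sup>2\<close>.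
\<close>

lemma card_sing_system_tail:
  assumes s: "0 < s" and E: "sing_system s E"
    and tail: "\<And>N. (\<Sum>j=n..<N. (norm (h j))\<^sup>2) \<le> B"
  shows "(real (card E) - real n) * s\<^sup>2 \<le> B"
proof -
  have fin: "finite E" and on: "orthonormal E" using E unfolding sing_system_def by blast+
  have normT: "s \<le> norm (T e)" if "e \<in> E" for e
    using sing_system_norm_T[OF E that] s by simp
  have pos: "0 < norm (T e)" if "e \<in> E" for e
    using normT[OF that] s by linarith
  define f where "f = (\<lambda>e. (1 / norm (T e)) *\<^sub>R T e)"
  have f_norm: "norm (f e) = 1" if "e \<in> E" for e
    using pos[OF that] by (simp add: f_def)
  have f_orth: "inner (f e) (f g) = 0" if "e \<in> E" "g \<in> E" "e \<noteq> g" for e g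
    using sing_system_inner_T[OF E that] by (simp add: f_def)
  have col: "(\<Sum>e\<in>E. (ell2_nth (f e) j)\<^sup>2) \<le> 1" for j
  proof -
    have "(\<Sum>e\<in>E. (inner (ell2_unit j) (f e))\<^sup>2) \<le> (norm (ell2_unit j))\<^sup>2"
      using fin f_norm f_orth by (rule Bessel_inequality)
    then show ?thesis by (simp add: inner_commute[of "ell2_unit j"] inner_ell2_unit norm_ell2_unit)
  qed
  have col': "(\<Sum>e\<in>E. (ell2_nth (f e) j)\<^sup>2) \<le> (norm (h j))\<^sup>2 / s\<^sup>2" for j
  proof -
    have "(\<Sum>e\<in>E. (ell2_nth (f e) j)\<^sup>2) \<le> (\<Sum>e\<in>E. (inner (h j) e)\<^sup>2 / s\<^sup>2)"
    proof (rule sum_mono)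
      fix e assume e: "e \<in> E"
      have "(ell2_nth (f e) j)\<^sup>2 = (inner (h j) e)\<^sup>2 / (norm (T e))\<^sup>2"
        by (simp add: f_def scaleR_ell2.rep_eq nth inner_commute[of e] power_divide)
      also have "\<dots> \<le> (inner (h j) e)\<^sup>2 / s\<^sup>2"
        using normT[OF e] pos[OF e] s by (intro divide_left_mono power_mono) auto
      finally show "(ell2_nth (f e) j)\<^sup>2 \<le> (inner (h j) e)\<^sup>2 / s\<^sup>2" .
    qed
    also have "\<dots> = (\<Sum>e\<in>E. (inner (h j) e)\<^sup>2) / s\<^sup>2" by (simp add: sum_divide_distrib)
    also have "\<dots> \<le> (norm (h j))\<^sup>2 / s\<^sup>2"
      using fin on by (intro divide_right_mono Bessel_inequality) (auto simp: orthonormal_inner orthonormal_def)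
    finally show ?thesis .
  qed
  have partial: "(\<Sum>e\<in>E. \<Sum>j<N. (ell2_nth (f e) j)\<^sup>2) \<le> real n + B / s\<^sup>2" for N
  proof -
    have "(\<Sum>e\<in>E. \<Sum>j<N. (ell2_nth (f e) j)\<^sup>2) = (\<Sum>j<N. \<Sum>e\<in>E. (ell2_nth (f e) j)\<^sup>2)"
      by (rule sum.swap)
    \<comment> \<open>Enlarging the range to \<open>n + N\<close> allows splitting at
      \<open>n\<close> even when \<open>N < n\<close>.\<close>
    also have "\<dots> \<le> (\<Sum>j<n+N. \<Sum>e\<in>E. (ell2_nth (f e) j)\<^sup>2)"
      by (intro sum_mono2) (auto intro: sum_nonneg)
    also have "\<dots> = (\<Sum>j<n. \<Sum>e\<in>E. (ell2_nth (f e) j)\<^sup>2) + (\<Sum>j=n..<n+N. \<Sum>e\<in>E. (ell2_nth (f e) j)\<^sup>2)"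
      by (simp add: lessThan_atLeast0 sum.atLeastLessThan_concat)
    also have "\<dots> \<le> (\<Sum>j<n. 1) + (\<Sum>j=n..<n+N. (norm (h j))\<^sup>2 / s\<^sup>2)"
      by (intro add_mono sum_mono col col')
    also have "\<dots> = real n + (\<Sum>j=n..<n+N. (norm (h j))\<^sup>2) / s\<^sup>2" by (simp add: sum_divide_distrib)
    also have "\<dots> \<le> real n + B / s\<^sup>2" using tail by (intro add_left_mono divide_right_mono) auto
    finally show ?thesis .
  qed
  \<comment> \<open>As \<open>N\<close> grows, the partial sums recover the full squared norms of
    the unit vectors \<open>f e\<close>, whose total is \<open>card E\<close>.\<close>
  have "(\<lambda>N. \<Sum>e\<in>E. \<Sum>j<N. (ell2_nth (f e) j)\<^sup>2) \<longlonglongrightarrow> (\<Sum>e\<in>E. (norm (f e))\<^sup>2)"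
    using ell2_norm_sums by (intro tendsto_sum) (simp add: sums_def)
  then have "(\<Sum>e\<in>E. (norm (f e))\<^sup>2) \<le> real n + B / s\<^sup>2"
    using partial by (intro LIMSEQ_le_const2) auto
  then have "real (card E) - real n \<le> B / s\<^sup>2" using f_norm by simp
  then show ?thesis using s by (simp add: field_simps)
qed

text \<open>The tail estimate with \<open>n = 0\<close> bounds \<open>card E\<close> by the squared
  Hilbert-Schmidt norm over the square of \<open>s\<close>.\<close>

sublocale adjoint_pair_bounded_systems T T_adj
proof
  fix s :: real assume s: "0 < s"
  have "card E \<le> nat \<lceil>(\<Sum>j. (norm (h j))\<^sup>2) / s\<^sup>2\<rceil>" if "sing_system s E" for E
  proof -
    have "(real (card E) - real 0) * s\<^sup>2 \<le> (\<Sum>j. (norm (h j))\<^sup>2)"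
      using summable_h by (intro card_sing_system_tail[OF s that] sum_le_suminf) auto
    then have "real (card E) \<le> (\<Sum>j. (norm (h j))\<^sup>2) / s\<^sup>2" using s by (simp add: field_simps)
    then show ?thesis by linarith
  qed
  then show "\<exists>K. \<forall>E. sing_system s E \<longrightarrow> card E \<le> K" by blast
qed

text \<open>Some \<open>h j\<close> lies outside the span of a given finite orthonormal
  \<open>E\<close>. Its residual \<open>h j - p\<close> is orthogonal to \<open>E\<close>, and the
  \<open>j\<close>-th coordinate of its image is its own squared norm, so \<open>T\<close> does not
  kill it. Systems of every size therefore exist.\<close>

lemma singular_value_pos:
  assumes inf: "\<And>E. finite E \<Longrightarrow> \<not> range h \<subseteq> span E" and "1 \<le> i"
  shows "0 < singular_value T i" "i \<le> sing_count T (singular_value T i)"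
proof -
  have "\<exists>x. (\<forall>e\<in>E. inner x e = 0) \<and> T x \<noteq> 0" if E: "finite E" "orthonormal E" for E
  proof -
    obtain j where j: "h j \<notin> span E" using inf[OF E(1)] image_subsetI[of UNIV h "span E"] by metis
    obtain p where p: "p \<in> span E" "\<And>v. v \<in> span E \<Longrightarrow> inner (h j - p) v = 0"
      using orthonormal_projection[OF E] by metis
    have "inner (h j - p) (h j) = inner (h j - p) (h j - p)"
      using p(2)[OF p(1)] unfolding inner_diff_right[of _ "h j" p] by simp
    moreover have "h j - p \<noteq> 0" using p(1) j by auto
    ultimately have "ell2_nth (T (h j - p)) j \<noteq> 0" by (simp add: nth)
    then have "T (h j - p) \<noteq> 0" by (metis zero_ell2.rep_eq)
    moreover have "\<forall>e\<in>E. inner (h j - p) e = 0" by (intro ballI p(2) span_base)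
    ultimately show ?thesis by (intro exI[of _ "h j - p"] conjI)
  qed
  from ex_large_sing_system[OF compact this, of i]
  obtain s E where "0 < s" "sing_system s E" "card E = i" by blast
  from singular_value_witness[OF \<open>1 \<le> i\<close> this(1,2)] this(3)
  show "0 < singular_value T i" "i \<le> sing_count T (singular_value T i)" by simp_all
qed

text \<open>A system realising the count at the threshold \<open>singular_value T i\<close> has at
  least \<open>i\<close> elements, and the tail estimate applies to it.\<close>

lemma singular_value_tail:
  assumes inf: "\<And>E. finite E \<Longrightarrow> \<not> range h \<subseteq> span E" and i: "1 \<le> i"
    and tail: "\<And>N. (\<Sum>j=n..<N. (norm (h j))\<^sup>2) \<le> B"
  shows "(real i - real n) * (singular_value T i)\<^sup>2 \<le> B"
proof -
  note sv = singular_value_pos[OF inf i]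
  obtain E where E: "sing_system (singular_value T i) E" "card E = sing_count T (singular_value T i)"
    using sing_count_system[OF sv(1)] by blast
  have "(real i - real n) * (singular_value T i)\<^sup>2 \<le> (real (card E) - real n) * (singular_value T i)\<^sup>2"
    using sv(2) E(2) by (intro mult_right_mono) auto
  also have "\<dots> \<le> B" by (rule card_sing_system_tail[OF sv(1) E(1) tail])
  finally show ?thesis .
qed

end

section \<open>The moment operator\<close>

instance L2 :: banach ..

section \<open>Monomials in \<open>L2\<close> and their linear independence\<close>

definition monomial :: "nat \<Rightarrow> L2"
  where "monomial j = abs_L2 (\<lambda>t. t ^ j)"

lemma inner_abs_L2:
  assumes "square_integrable unit_interval f" "square_integrable unit_interval g"
  shows "inner (abs_L2 f) (abs_L2 g) = (\<integral>t. f t * g t \<partial>unit_interval)"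
  using assms by (simp add: inner_L2.abs_eq)

lemma inner_monomial:
  "square_integrable unit_interval f \<Longrightarrow>
    inner (abs_L2 f) (monomial j) = (\<integral>t. f t * t ^ j \<partial>unit_interval)"
  unfolding monomial_def by (rule inner_abs_L2[OF _ square_integrable_power])

lemma norm_monomial: "(norm (monomial j))\<^sup>2 = 1 / real (2 * j + 1)"
proof -
  have "(norm (monomial j))\<^sup>2 = (\<integral>t. t ^ j * t ^ j \<partial>unit_interval)"
    unfolding power2_norm_eq_inner using inner_monomial[OF square_integrable_power, of j j]
    by (simp only: monomial_def)
  also have "\<dots> = (\<integral>t. t ^ (2 * j) \<partial>unit_interval)"
    by (simp only: mult_2 power_add)
  also have "\<dots> = 1 / real (2 * j + 1)"
    by (rule has_bochner_integral_integral_eq[OF has_bochner_integral_unit_interval_power])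
  finally show ?thesis .
qed

lemma L2_norm_power2:
  "square_integrable unit_interval f \<Longrightarrow> (norm (abs_L2 f))\<^sup>2 = (\<integral>t. (f t)\<^sup>2 \<partial>unit_interval)"
  unfolding power2_norm_eq_inner by (simp add: inner_abs_L2 power2_eq_square)

lemma abs_L2_eq_imp_AE:
  assumes "square_integrable unit_interval f" "square_integrable unit_interval g" "abs_L2 f = abs_L2 g"
  shows "AE t in unit_interval. f t = g t"
proof -
  have "(\<integral>t. (f t - g t)\<^sup>2 \<partial>unit_interval) = 0"
    using L2_norm_diff[OF assms(1,2)] assms(3) by simp
  moreover have "integrable unit_interval (\<lambda>t. (f t - g t)\<^sup>2)"
    using square_integrable_diff[OF assms(1,2)] by (simp add: square_integrable_def)
  ultimately have "AE t in unit_interval. (f t - g t)\<^sup>2 = 0"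
    by (subst (asm) integral_nonneg_eq_0_iff_AE) auto
  then show ?thesis by (rule eventually_mono) simp
qed

text \<open>The unit interval has positive measure and \<open>Z\<close> has measure zero. This
  produces a point at which an identity holding almost everywhere is true but which is not one of
  finitely many roots.\<close>

lemma AE_unit_interval_ex:
  assumes "AE t in unit_interval. P t" "finite Z"
  shows "\<exists>t. t \<notin> Z \<and> P t"
proof (rule ccontr)
  assume no: "\<not> ?thesis"
  have "AE t in lborel. t \<in> {0<..<1} \<longrightarrow> P t"
    using assms(1) by (simp add: AE_restrict_space_iff)
  moreover have "AE t in lborel. t \<notin> Z"
    by (rule AE_not_in[OF finite_imp_null_set_lborel[OF assms(2)]])
  ultimately have "AE t in lborel. t \<notin> {0<..<1::real}"
    by eventually_elim (use no in auto)
  then have "{0<..<1::real} \<in> null_sets lborel" by (subst AE_iff_null_sets) auto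
  then show False by (simp add: null_sets_def)
qed

lemma square_integrable_poly: "square_integrable unit_interval (\<lambda>t. \<Sum>i\<in>I. a i * t ^ i)"
  by (intro square_integrable_sum square_integrable_scale square_integrable_power)

lemma abs_L2_poly: "abs_L2 (\<lambda>t. \<Sum>i<n. a i * t ^ i) = (\<Sum>i<n. a i *\<^sub>R monomial i)"
proof (induction n)
  case 0
  then show ?case by (simp add: zero_L2_def)
next
  case (Suc n)
  have "abs_L2 (\<lambda>t. \<Sum>i<Suc n. a i * t ^ i) =
      abs_L2 (\<lambda>t. \<Sum>i<n. a i * t ^ i) + abs_L2 (\<lambda>t. a n * t ^ n)"
    using square_integrable_poly[of a "{..<n}"] square_integrable_scale[OF square_integrable_power, of "a n" n]
    by (simp add: plus_L2.abs_eq)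
  also have "abs_L2 (\<lambda>t. a n * t ^ n) = a n *\<^sub>R monomial n"
    unfolding monomial_def using square_integrable_power[of n] by (simp add: scaleR_L2.abs_eq)
  finally show ?case using Suc by simp
qed

text \<open>A linear relation would make a polynomial with leading coefficient 1 vanish almost
  everywhere on the unit interval, although it has only finitely many roots.\<close>

lemma monomial_notin_span: "monomial n \<notin> span (monomial ` {..<n})"
proof
  assume "monomial n \<in> span (monomial ` {..<n})"
  \<comment> \<open>Coefficients are indexed by exponents, not by elements of the image, so this
    step does not depend on the monomials being distinct.\<close>
  moreover have "span (monomial ` {..<n}) \<subseteq> range (\<lambda>a. \<Sum>i<n. a i *\<^sub>R monomial i)"
  proof (rule span_minimal)
    show "monomial ` {..<n} \<subseteq> range (\<lambda>a. \<Sum>i<n. a i *\<^sub>R monomial i)"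
    proof
      fix x assume "x \<in> monomial ` {..<n}"
      then obtain k where k: "k < n" "x = monomial k" by blast
      have "(\<Sum>i<n. (if i = k then 1 else 0) *\<^sub>R monomial i) = (\<Sum>i<n. if i = k then monomial k else 0)"
        by (intro sum.cong) auto
      then have "x = (\<Sum>i<n. (if i = k then 1 else 0) *\<^sub>R monomial i)" using k by simp
      then show "x \<in> range (\<lambda>a. \<Sum>i<n. a i *\<^sub>R monomial i)"
        by (rule range_eqI[of _ _ "\<lambda>i. if i = k then 1 else 0"])
    qed
    show "subspace (range (\<lambda>a. \<Sum>i<n. a i *\<^sub>R monomial i))"
      unfolding subspace_def
    proof (intro conjI ballI allI)
      show "0 \<in> range (\<lambda>a. \<Sum>i<n. a i *\<^sub>R monomial i)" by (rule range_eqI[of _ _ "\<lambda>i. 0"]) simp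
      fix x assume "x \<in> range (\<lambda>a. \<Sum>i<n. a i *\<^sub>R monomial i)"
      then obtain a where a: "x = (\<Sum>i<n. a i *\<^sub>R monomial i)" by blast
      show "c *\<^sub>R x \<in> range (\<lambda>a. \<Sum>i<n. a i *\<^sub>R monomial i)" for c
        by (rule range_eqI[of _ _ "\<lambda>i. c * a i"]) (simp add: a scaleR_sum_right)
      fix y assume "y \<in> range (\<lambda>a. \<Sum>i<n. a i *\<^sub>R monomial i)"
      then obtain b where b: "y = (\<Sum>i<n. b i *\<^sub>R monomial i)" by blast
      show "x + y \<in> range (\<lambda>a. \<Sum>i<n. a i *\<^sub>R monomial i)"
        by (rule range_eqI[of _ _ "\<lambda>i. a i + b i"]) (simp add: a b scaleR_add_left sum.distrib)
    qed
  qed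
  ultimately obtain a where "monomial n = (\<Sum>i<n. a i *\<^sub>R monomial i)" by blast
  then have eq: "abs_L2 (\<lambda>t. t ^ n) = abs_L2 (\<lambda>t. \<Sum>i<n. a i * t ^ i)"
    unfolding abs_L2_poly by (simp add: monomial_def)
  have AE: "AE t in unit_interval. t ^ n = (\<Sum>i<n. a i * t ^ i)"
    by (rule abs_L2_eq_imp_AE[OF square_integrable_power square_integrable_poly eq])
  define c where "c = (\<lambda>i. if i = n then 1 else - a i)"
  have c: "(\<Sum>i\<le>n. c i * t ^ i) = t ^ n - (\<Sum>i<n. a i * t ^ i)" for t
  proof -
    have "(\<Sum>i<n. c i * t ^ i) = (\<Sum>i<n. - (a i * t ^ i))" by (intro sum.cong) (auto simp: c_def)
    then show ?thesis by (simp add: lessThan_Suc_atMost[symmetric] c_def sum_negf)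
  qed
  have "finite {t. (\<Sum>i\<le>n. c i * t ^ i) = 0}"
    by (rule polyfun_rootbound_finite[of n]) (auto simp: c_def)
  then show False using AE_unit_interval_ex[OF AE] by (auto simp: c)
qed

lemma monomial_independent: "independent (monomial ` {..<n}) \<and> card (monomial ` {..<n}) = n"
proof (induction n)
  case (Suc n)
  have "monomial n \<notin> monomial ` {..<n}" using monomial_notin_span[of n] by (metis span_base)
  then show ?case
    using Suc monomial_notin_span[of n] by (simp add: lessThan_Suc independent_insert)
qed (simp add: independent_empty)

lemma monomials_infinite_dim:
  assumes "finite E"
  shows "\<not> range monomial \<subseteq> span E"
proof
  assume "range monomial \<subseteq> span E"
  then have sub: "monomial ` {..<Suc (card E)} \<subseteq> span E"
    by (rule order_trans[OF image_mono[OF subset_UNIV]])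
  note ind = monomial_independent[of "Suc (card E)"]
  have "card (monomial ` {..<Suc (card E)}) \<le> card E"
    by (rule conjunct2[OF independent_span_bound[OF assms conjunct1[OF ind] sub]])
  then show False unfolding conjunct2[OF ind] by simp
qed

lemma nth_H_op: "ell2_nth (H_op x) j = inner x (monomial j)"
proof -
  obtain f where f: "square_integrable unit_interval f" "x = abs_L2 f" by (rule L2_cases)
  have "ell2_nth (H_op x) = (\<lambda>j. \<integral>t. f t * t ^ j \<partial>unit_interval)"
    unfolding f(2) using f(1) moments_square_summable(1)[OF f(1)]
    by (subst H_op.abs_eq) (simp_all add: Abs_ell2_inverse)
  then show ?thesis by (simp add: f(2) inner_monomial[OF f(1)])
qed

section \<open>Boundedness of the three operators\<close>

lemma bounded_linear_H_op: "bounded_linear H_op"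
proof (rule bounded_linear_intro)
  show "H_op (x + y) = H_op x + H_op y" for x y
    by (rule ell2_eqI) (simp add: nth_H_op plus_ell2.rep_eq inner_add_left)
  show "H_op (c *\<^sub>R x) = c *\<^sub>R H_op x" for c x
    by (rule ell2_eqI) (simp add: nth_H_op scaleR_ell2.rep_eq)
  \<comment> \<open>The constant comes from Hilbert's inequality, through the bound on the sum of
    squared moments.\<close>
  show "norm (H_op x) \<le> norm x * sqrt pi" for x
  proof (rule power2_le_imp_le)
    obtain f where f: "square_integrable unit_interval f" "x = abs_L2 f" by (rule L2_cases)
    then show "(norm (H_op x))\<^sup>2 \<le> (norm x * sqrt pi)\<^sup>2"
      using moments_square_summable(2)[OF f(1)]
      by (simp add: ell2_norm_power2 nth_H_op inner_monomial power_mult_distrib L2_norm_power2 mult.commute)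
  qed simp
qed

lemma bounded_linear_D_op: "bounded_linear D_op"
proof (rule bounded_linear_intro)
  show "D_op (x + y) = D_op x + D_op y" for x y
    by (rule ell2_eqI) (simp add: D_op.rep_eq plus_ell2.rep_eq add_divide_distrib)
  show "D_op (c *\<^sub>R x) = c *\<^sub>R D_op x" for c x
    by (rule ell2_eqI) (simp add: D_op.rep_eq scaleR_ell2.rep_eq)
  show "norm (D_op y) \<le> norm y * 1" for y
  proof (rule power2_le_imp_le)
    have "(ell2_nth (D_op y) j)\<^sup>2 \<le> (ell2_nth y j)\<^sup>2" for j
    proof -
      have "\<bar>ell2_nth y j\<bar> / real (j + 1) \<le> \<bar>ell2_nth y j\<bar> / 1" by (intro divide_left_mono) auto
      then show ?thesis by (simp add: D_op.rep_eq abs_le_square_iff[symmetric])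
    qed
    then show "(norm (D_op y))\<^sup>2 \<le> (norm y * 1)\<^sup>2"
      by (simp add: ell2_norm_power2 suminf_le ell2_summable)
  qed simp
qed

text \<open>On \<open>{t<..<1}\<close> the factor \<open>1 / s\<close> is at most
  \<open>1 / t\<close>, and \<open>x\<close> is integrable on the unit interval as a product of two
  square-integrable functions. Additivity of \<open>Cstar_op\<close> rests on this.\<close>

lemma integrable_Cstar_integrand:
  assumes x: "square_integrable unit_interval x" and t: "0 < t"
  shows "set_integrable lborel {t<..<1} (\<lambda>s. x s / s)"
proof -
  have X: "square_integrable lborel (\<lambda>s. indicator {0<..<1} s * x s)"
    using x by (simp add: square_integrable_unit_interval_iff)
  have "square_integrable lborel (\<lambda>s. indicator {0<..<1::real} s :: real)"
    by (simp add: square_integrable_def power2_eq_square flip: indicator_inter_arith)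
  from square_integrable_mult[OF X this]
  have I: "integrable lborel (\<lambda>s. (1/t) * (indicator {0<..<1} s * x s * indicator {0<..<1} s))" by simp
  have [measurable]: "(\<lambda>s. indicator {0<..<1} s * x s) \<in> borel_measurable borel"
    using X by (simp add: square_integrable_def)
  have eq: "(\<lambda>s. indicator {t<..<1} s *\<^sub>R (x s / s)) =
      (\<lambda>s. indicator {t<..<1} s * (indicator {0<..<1} s * x s) / s)"
    using t by (auto simp: indicator_def)
  show ?thesis
    unfolding set_integrable_def
  proof (rule Bochner_Integration.integrable_bound[OF I])
    show "(\<lambda>s. indicator {t<..<1} s *\<^sub>R (x s / s)) \<in> borel_measurable lborel"
      unfolding eq by measurable
    have "\<bar>x s\<bar> / s \<le> \<bar>x s\<bar> / t" if "t < s" for s using that t by (intro divide_left_mono) auto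
    then show "AE s in lborel. norm (indicator {t<..<1} s *\<^sub>R (x s / s)) \<le>
        norm (1 / t * (indicator {0<..<1} s * x s * indicator {0<..<1} s))"
      using t by (intro AE_I2) (auto simp: indicator_def abs_mult)
  qed
qed

lemma bounded_linear_Cstar_op: "bounded_linear Cstar_op"
proof (rule bounded_linear_intro)
  show "Cstar_op (x + y) = Cstar_op x + Cstar_op y" for x y
  proof transfer
    fix x y :: "real \<Rightarrow> real"
    assume x: "square_integrable unit_interval x \<and> square_integrable unit_interval x \<and>
        (AE t in unit_interval. x t = x t)"
      and y: "square_integrable unit_interval y \<and> square_integrable unit_interval y \<and>
        (AE t in unit_interval. y t = y t)"
    have "(LBINT s:{t<..<1}. (x s + y s) / s) = (LBINT s:{t<..<1}. x s / s) + (LBINT s:{t<..<1}. y s / s)"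
      if "0 < t" for t
      using integrable_Cstar_integrand[OF _ that] x y by (simp add: add_divide_distrib)
    then show "square_integrable unit_interval (\<lambda>t. LBINT s:{t<..<1}. (x s + y s) / s) \<and>
        square_integrable unit_interval (\<lambda>t. (LBINT s:{t<..<1}. x s / s) + (LBINT s:{t<..<1}. y s / s)) \<and>
        (AE t in unit_interval. (LBINT s:{t<..<1}. (x s + y s) / s) =
          (LBINT s:{t<..<1}. x s / s) + (LBINT s:{t<..<1}. y s / s))"
      using x y by (auto intro!: Hardy_inequality(1) square_integrable_add simp: AE_restrict_space_iff)
  qed
  show "Cstar_op (c *\<^sub>R x) = c *\<^sub>R Cstar_op x" for c x
  proof transfer
    fix c :: real and x :: "real \<Rightarrow> real"
    assume x: "square_integrable unit_interval x \<and> square_integrable unit_interval x \<and>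
        (AE t in unit_interval. x t = x t)"
    have "(LBINT s:{t<..<1}. c * x s / s) = c * (LBINT s:{t<..<1}. x s / s)" for t
      using set_integral_mult_right[of lborel "{t<..<1}" c "\<lambda>s. x s / s"] by simp
    then show "square_integrable unit_interval (\<lambda>t. LBINT s:{t<..<1}. c * x s / s) \<and>
        square_integrable unit_interval (\<lambda>t. c * (LBINT s:{t<..<1}. x s / s)) \<and>
        (AE t in unit_interval. (LBINT s:{t<..<1}. c * x s / s) = c * (LBINT s:{t<..<1}. x s / s))"
      using x by (auto intro!: Hardy_inequality(1) square_integrable_scale)
  qed
  \<comment> \<open>Hardy's inequality with constant 4 for squared norms.\<close>
  show "norm (Cstar_op x) \<le> norm x * 2" for x
  proof (rule power2_le_imp_le)
    obtain f where f: "square_integrable unit_interval f" "x = abs_L2 f" by (rule L2_cases)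
    then show "(norm (Cstar_op x))\<^sup>2 \<le> (norm x * 2)\<^sup>2"
      using Hardy_inequality[OF f(1)]
      by (simp add: Cstar_op.abs_eq L2_norm_power2 power_mult_distrib)
  qed simp
qed

section \<open>The identity \<open>D H = H C*\<close>\<close>

lemma has_bochner_integral_power_Ioo:
  assumes "0 < s"
  shows "has_bochner_integral lborel (\<lambda>t. indicator {0<..<s} t * t ^ n) (s ^ (n + 1) / real (n + 1))"
proof -
  have "has_bochner_integral lborel (\<lambda>t. t ^ n * indicator {0..s} t) (s ^ Suc n / real (Suc n) - 0 ^ Suc n / real (Suc n))"
    by (rule has_bochner_integral_FTC_Icc_nonneg)
      (use assms in \<open>auto intro!: derivative_eq_intros simp del: power_Suc\<close>)
  then have *: "has_bochner_integral lborel (\<lambda>t. indicator {0..s} t * t ^ n) (s ^ (n + 1) / real (n + 1))"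
    by (simp add: mult.commute)
  show ?thesis
  proof (rule has_bochner_integralI_AE[OF *])
    have "AE t in lborel. t \<noteq> (0::real) \<and> t \<noteq> s"
      using AE_lborel_singleton[of "0::real"] AE_lborel_singleton[of s] by (rule AE_conjI)
    then show "AE t in lborel. indicator {0..s} t * t ^ n = indicator {0<..<s} t * t ^ n"
      by (rule eventually_mono) (auto simp: indicator_def)
  qed measurable
qed

text \<open>Fubini on the triangle \<open>0 < t < s < 1\<close>: integrating \<open>t ^ j\<close>
  over \<open>{0<..<s}\<close> gives \<open>s ^ (j + 1) / (j + 1)\<close>, whose extra factor
  \<open>s\<close> cancels the weight \<open>1 / s\<close>.\<close>

lemma moment_Cstar:
  assumes x: "square_integrable unit_interval x"
  shows "(\<integral>t. (LBINT s:{t<..<1}. x s / s) * t ^ j \<partial>unit_interval) =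
    (\<integral>s. x s * s ^ j \<partial>unit_interval) / real (j + 1)"
proof -
  define X where "X = (\<lambda>s. indicator {0<..<1} s * x s)"
  have "square_integrable lborel X"
    using x unfolding X_def by (simp add: square_integrable_unit_interval_iff)
  then have [measurable]: "X \<in> borel_measurable borel" by (simp add: square_integrable_def)
  \<comment> \<open>The kernel is extended by zero to the plane. Using \<open>X\<close>, which
    vanishes off the unit interval, makes it Borel measurable there.\<close>
  define k where "k = (\<lambda>s t. if 0 < t \<and> t < s \<and> s < 1 then t ^ j * (X s / s) else 0)"
  have km [measurable]: "case_prod k \<in> borel_measurable (lborel \<Otimes>\<^sub>M lborel)"
    unfolding k_def by measurable
  have k_eq: "k s = (\<lambda>t. (X s / s) * (indicator {0<..<s} t * t ^ j))" for s
    by (auto simp: k_def X_def indicator_def)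
  have hk: "has_bochner_integral lborel (k s) (X s * s ^ j / real (j + 1))" for s
  proof (cases "0 < s \<and> s < 1")
    case True
    then show ?thesis
      using has_bochner_integral_mult_right[OF has_bochner_integral_power_Ioo[of s j], of "X s / s"]
      unfolding k_eq by simp
  next
    case False
    then have "X s = 0" by (auto simp: X_def)
    then show ?thesis unfolding k_eq by (simp add: has_bochner_integral_iff)
  qed
  have hk': "(\<integral>t. norm (k s t) \<partial>lborel) = \<bar>X s * s ^ j / real (j + 1)\<bar>" for s
  proof (cases "0 < s \<and> s < 1")
    case True
    have "(\<lambda>t. norm (k s t)) = (\<lambda>t. \<bar>X s / s\<bar> * (indicator {0<..<s} t * t ^ j))"
      unfolding k_eq by (auto simp: abs_mult indicator_def)
    then show ?thesis
      using has_bochner_integral_mult_right[OF has_bochner_integral_power_Ioo[of s j], of "\<bar>X s / s\<bar>"] True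
      by (simp add: has_bochner_integral_iff abs_mult)
  next
    case False
    then have "X s = 0" by (auto simp: X_def)
    then show ?thesis unfolding k_eq by simp
  qed
  have IX: "integrable lborel (\<lambda>s. X s * s ^ j)"
  proof -
    have "integrable unit_interval (\<lambda>s. x s * s ^ j)"
      by (rule square_integrable_mult[OF x square_integrable_power])
    then show ?thesis by (simp add: integrable_restrict_space X_def mult.assoc)
  qed
  have int: "integrable (lborel \<Otimes>\<^sub>M lborel) (case_prod k)"
  proof (rule lborel_pair.Fubini_integrable[OF km])
    have "integrable lborel (\<lambda>s. \<bar>X s * s ^ j / real (j + 1)\<bar>)" using IX by simp
    then show "integrable lborel (\<lambda>s. \<integral>t. norm (case (s, t) of (s, t) \<Rightarrow> k s t) \<partial>lborel)"
      by (simp add: hk' del: real_norm_def)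
    show "AE s in lborel. integrable lborel (\<lambda>t. case (s, t) of (s, t) \<Rightarrow> k s t)"
      using hk by (simp add: has_bochner_integral_iff)
  qed
  have "(\<integral>t. (LBINT s:{t<..<1}. x s / s) * t ^ j \<partial>unit_interval) =
      (\<integral>t. indicator {0<..<1} t * ((LBINT s:{t<..<1}. x s / s) * t ^ j) \<partial>lborel)"
    by (simp add: integral_restrict_space)
  also have "\<dots> = (\<integral>t. (\<integral>s. k s t \<partial>lborel) \<partial>lborel)"
  proof (rule Bochner_Integration.integral_cong[OF refl])
    fix t :: real
    show "indicator {0<..<1} t * ((LBINT s:{t<..<1}. x s / s) * t ^ j) = (\<integral>s. k s t \<partial>lborel)"
    proof (cases "0 < t \<and> t < 1")
      case True
      then have "k s t = t ^ j * (indicator {t<..<1} s *\<^sub>R (x s / s))" for s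
        by (auto simp: k_def X_def indicator_def)
      then have "(\<integral>s. k s t \<partial>lborel) = t ^ j * (LBINT s:{t<..<1}. x s / s)"
        unfolding set_lebesgue_integral_def by (simp only: integral_mult_right_zero)
      then show ?thesis using True by (simp add: mult.commute)
    next
      case False
      then have "k s t = 0" for s by (auto simp: k_def)
      then show ?thesis using False by simp
    qed
  qed
  also have "\<dots> = (\<integral>s. (\<integral>t. k s t \<partial>lborel) \<partial>lborel)"
    by (rule lborel_pair.Fubini_integral[OF int])
  also have "\<dots> = (\<integral>s. X s * s ^ j / real (j + 1) \<partial>lborel)"
    using hk by (simp add: has_bochner_integral_iff)
  also have "\<dots> = (\<integral>s. x s * s ^ j \<partial>unit_interval) / real (j + 1)"
    by (simp add: integral_restrict_space X_def mult.assoc)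
  finally show ?thesis .
qed

lemma D_H_eq_H_Cstar: "D_op \<circ> H_op = H_op \<circ> Cstar_op"
proof (rule ext, rule ell2_eqI)
  fix x j
  obtain f where f: "square_integrable unit_interval f" "x = abs_L2 f" by (rule L2_cases)
  then show "ell2_nth ((D_op \<circ> H_op) x) j = ell2_nth ((H_op \<circ> Cstar_op) x) j"
    using Hardy_inequality(1)[OF f(1)] moment_Cstar[OF f(1), of j]
    by (simp add: D_op.rep_eq nth_H_op Cstar_op.abs_eq inner_monomial)
qed

section \<open>Decay rate and degree of ill-posedness\<close>

lemma liminf_log_ratio_ge:
  fixes s :: "nat \<Rightarrow> real"
  assumes s: "\<And>i. 1 \<le> i \<Longrightarrow> 0 < s i" "\<And>i. 1 \<le> i \<Longrightarrow> s i \<le> c / real i powr p" and c: "0 < c"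
  shows "liminf (\<lambda>i. ereal (- ln (s i) / ln (real i))) \<ge> ereal p"
proof -
  have "(\<lambda>i. ln c / ln (real i)) \<longlonglongrightarrow> 0"
    by (rule real_tendsto_divide_at_top[OF tendsto_const
          filterlim_compose[OF ln_at_top filterlim_real_sequentially]])
  then have "(\<lambda>i. p - ln c / ln (real i)) \<longlonglongrightarrow> p - 0" by (rule tendsto_diff[OF tendsto_const])
  then have "liminf (\<lambda>i. ereal (p - ln c / ln (real i))) = ereal p"
    by (intro lim_imp_Liminf sequentially_bot) simp
  moreover have "liminf (\<lambda>i. ereal (p - ln c / ln (real i))) \<le> liminf (\<lambda>i. ereal (- ln (s i) / ln (real i)))"
  \<comment> \<open>The comparison starts at 2 because \<open>ln 1 = 0\<close> appears in the
    denominator.\<close>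
  proof (rule Liminf_mono, rule eventually_sequentiallyI[of 2])
    fix i :: nat assume i: "2 \<le> i"
    then have "ln (s i) \<le> ln (c / real i powr p)" using s[of i] by (intro ln_mono) auto
    also have "\<dots> = ln c - p * ln (real i)" using i c by (simp add: ln_div)
    finally have "p * ln (real i) - ln c \<le> - ln (s i)" by simp
    moreover have "0 < ln (real i)" using i by simp
    ultimately have "(p * ln (real i) - ln c) / ln (real i) \<le> - ln (s i) / ln (real i)"
      by (intro divide_right_mono) auto
    then have "p - ln c / ln (real i) \<le> - ln (s i) / ln (real i)"
      using \<open>0 < ln (real i)\<close> by (simp add: diff_divide_distrib)
    then show "ereal (p - ln c / ln (real i)) \<le> ereal (- ln (s i) / ln (real i))" by simp
  qed
  ultimately show ?thesis by simp
qed

definition scaled_monomial :: "nat \<Rightarrow> L2"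
  where "scaled_monomial j = (1 / real (j + 1)) *\<^sub>R monomial j"

lemma norm_scaled_monomial:
  "(norm (scaled_monomial j))\<^sup>2 = 1 / ((real (j + 1))\<^sup>2 * real (2 * j + 1))"
  by (simp add: scaled_monomial_def power_mult_distrib norm_monomial power_divide)

text \<open>A telescoping majorant. With \<open>x = j + 1\<close> it reduces to
  \<open>(x + 1)^2 \<le> 2 (2x + 1) (2x - 1)\<close>, which holds for \<open>x \<ge> 1\<close>. With
  numerators 1 instead of 2 the estimate would fail at \<open>j = 0\<close>.\<close>

lemma norm_scaled_monomial_le:
  "(norm (scaled_monomial j))\<^sup>2 \<le> 2 / (real j + 1)\<^sup>2 - 2 / (real j + 2)\<^sup>2"
proof -
  define x where "x = real j + 1"
  have x: "1 \<le> x" "x \<noteq> 0" "x + 1 \<noteq> 0" "0 < 2 * x - 1" by (simp_all add: x_def)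
  have "x \<le> x * x" using mult_left_mono[of 1 x x] x(1) by simp
  moreover have "(x + 1)\<^sup>2 = x * x + 2 * x + 1" "2 * (2 * x + 1) * (2 * x - 1) = 8 * (x * x) - 2"
    by (simp_all add: power2_eq_square algebra_simps)
  ultimately have "(x + 1)\<^sup>2 \<le> 2 * (2 * x + 1) * (2 * x - 1)" using x(1) by linarith
  then have "1 / (2 * x - 1) \<le> 2 * (2 * x + 1) / (x + 1)\<^sup>2"
    using x by (simp add: divide_simps)
  then have "1 / x\<^sup>2 * (1 / (2 * x - 1)) \<le> 1 / x\<^sup>2 * (2 * (2 * x + 1) / (x + 1)\<^sup>2)"
    by (rule mult_left_mono) simp
  also have "\<dots> = 2 / x\<^sup>2 - 2 / (x + 1)\<^sup>2"
    using x(2,3) by (simp add: divide_simps) (simp add: power2_eq_square algebra_simps)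
  finally show ?thesis
    by (simp add: norm_scaled_monomial x_def add.commute)
qed

lemma scaled_monomial_tail: "(\<Sum>j=n..<N. (norm (scaled_monomial j))\<^sup>2) \<le> 2 / (real n + 1)\<^sup>2"
proof -
  have "(\<Sum>j=n..<N. (norm (scaled_monomial j))\<^sup>2) \<le> 2 / (real n + 1)\<^sup>2 - 2 / (real N + 1)\<^sup>2"
    if "n \<le> N"
    using that
  proof (induction N rule: dec_induct)
    case (step N)
    then show ?case using norm_scaled_monomial_le[of N] by (simp add: add.commute)
  qed simp
  then show ?thesis by (cases "n \<le> N") (auto intro: order_trans)
qed

lemma summable_scaled_monomial: "summable (\<lambda>j. (norm (scaled_monomial j))\<^sup>2)"
  using scaled_monomial_tail[of 0]
  by (intro summableI_nonneg_bounded[of _ 2]) (simp_all add: atLeast0LessThan)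

lemma scaled_monomials_infinite_dim:
  assumes "finite E"
  shows "\<not> range scaled_monomial \<subseteq> span E"
proof
  assume sub: "range scaled_monomial \<subseteq> span E"
  have "monomial j \<in> span E" for j
  proof -
    have "real (j + 1) *\<^sub>R scaled_monomial j \<in> span E"
      by (intro span_scale subsetD[OF sub] rangeI)
    then show ?thesis by (simp add: scaled_monomial_def)
  qed
  then have "range monomial \<subseteq> span E" by (rule image_subsetI)
  with monomials_infinite_dim[OF assms] show False by (rule notE)
qed

interpretation DH: hilbert_schmidt "D_op \<circ> H_op" scaled_monomial
proof
  show "ell2_nth ((D_op \<circ> H_op) x) j = inner x (scaled_monomial j)" for x j
    by (simp add: D_op.rep_eq nth_H_op scaled_monomial_def)
qed (rule summable_scaled_monomial)

lemma singular_value_DH_le: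
  assumes i: "1 \<le> i"
  shows "singular_value (D_op \<circ> H_op) i \<le> 4 / real i powr (3/2)"
proof (rule power2_le_imp_le)
  \<comment> \<open>Halving balances the two factors: \<open>i - n\<close> and \<open>n + 1\<close>
    are both at least \<open>i / 2\<close>, so \<open>(i / 2) s^2 \<le> 8 / i^2\<close>. This gives
    \<open>s^2 \<le> 16 / i^3\<close> and hence the constant 4.\<close>
  define s n where "s = singular_value (D_op \<circ> H_op) i" and "n = i div 2"
  have ri: "0 < real i" using i by simp
  have n: "real i / 2 \<le> real n + 1" "real i / 2 \<le> real i - real n"
  proof -
    have "i \<le> 2 * n + 1" "2 * n \<le> i" unfolding n_def by simp_all
    then show "real i / 2 \<le> real n + 1" "real i / 2 \<le> real i - real n" by linarith+
  qed
  have "(real i / 2) * s\<^sup>2 \<le> (real i - real n) * s\<^sup>2" by (intro mult_right_mono n) simp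
  also have "\<dots> \<le> 2 / (real n + 1)\<^sup>2"
    unfolding s_def by (rule DH.singular_value_tail[OF scaled_monomials_infinite_dim i scaled_monomial_tail])
  also have "\<dots> \<le> 2 / (real i / 2)\<^sup>2"
    using n(1) ri by (intro divide_left_mono power_mono) auto
  finally have "s\<^sup>2 \<le> 16 / real i ^ 3"
    using ri by (simp add: field_simps power2_eq_square power3_eq_cube)
  also have "\<dots> = (4 / real i powr (3/2))\<^sup>2"
  proof -
    have "(real i powr (3/2))\<^sup>2 = real i powr 3"
      unfolding power2_eq_square by (simp flip: powr_add)
    then show ?thesis using ri by (simp add: power_divide)
  qed
  finally show "(singular_value (D_op \<circ> H_op) i)\<^sup>2 \<le> (4 / real i powr (3/2))\<^sup>2"
    by (simp add: s_def)
qed simp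

theorem theorem1:
  shows "bounded_linear H_op \<and> bounded_linear D_op \<and> bounded_linear Cstar_op \<and>
    D_op \<circ> H_op = H_op \<circ> Cstar_op \<and>
    compact_operator (D_op \<circ> H_op) \<and>
    (\<forall>i\<ge>1. 0 < singular_value (D_op \<circ> H_op) i) \<and>
    (\<exists>c>0. \<forall>i\<ge>1. singular_value (D_op \<circ> H_op) i \<le> c / real i powr (3/2)) \<and>
    liminf (\<lambda>i. ereal (- ln (singular_value (D_op \<circ> H_op) i) / ln (real i))) \<ge> 3/2"
proof -
  have pos: "0 < singular_value (D_op \<circ> H_op) i" if "1 \<le> i" for i
    by (rule DH.singular_value_pos(1)[OF scaled_monomials_infinite_dim that])
  have "ereal (3/2) \<le> liminf (\<lambda>i. ereal (- ln (singular_value (D_op \<circ> H_op) i) / ln (real i)))"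
    by (rule liminf_log_ratio_ge[OF pos singular_value_DH_le]) auto
  then have lim: "3/2 \<le> liminf (\<lambda>i. ereal (- ln (singular_value (D_op \<circ> H_op) i) / ln (real i)))"
    by simp
  have "0 < (4::real)" by simp
  then have bound: "\<exists>c>0. \<forall>i\<ge>1. singular_value (D_op \<circ> H_op) i \<le> c / real i powr (3/2)"
    using singular_value_DH_le by (intro exI conjI allI impI)
  show ?thesis
    by (intro conjI allI impI bounded_linear_H_op bounded_linear_D_op bounded_linear_Cstar_op
        D_H_eq_H_Cstar DH.compact pos bound lim)
qed

end
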